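(* Fix $0<p<1$, let $L=\lambda_{\max}(K_\infty)$, $\alpha=\max\{p,1-p\}$, and $m(z)=\langle\phi,(zI-K_\infty)^{-1}\phi\rangle$ for $z\in\mathbb C\setminus\sigma(K_\infty)$. Then for every real $\lambda>\alpha L$, the following are equivalent: (1) $\lambda$ is an eigenvalue of $K_\infty$; (2) $m(\lambda/p)+m(\lambda/(1-p))=1$. Moreover every eigenvalue $\lambda>\alpha L$ of $K_\infty$ is simple. In particular, $L$ is the largest real number $\lambda>\alpha L$ satisfying $m(\lambda/p)+m(\lambda/(1-p))=1$, and $L$ is a simple eigenvalue.
   Context: Let $S_0(x)=x/3$, $S_2(x)=(x+2)/3$ on $[0,1]$ and let $C$ be the middle-third Cantor set. For $0<p<1$, $\mu_p$ is the unique Borel probability measure on $[0,1]$ with $\mu_p=p\,\mu_p\circ S_0^{-1}+(1-p)\,\mu_p\circ S_2^{-1}$. For words $w\in\{0,2\}^n$, $S_w=S_{w_1}\circ\cdots\circ S_{w_n}$, $C_w=S_w(C)$. Inner product $\langle f,g\rangle=\int\overline fg\,d\mu_p$; $\phi=1_C$. $K_mf=\sum_{|u|\le m}\langle1_{C_u},f\rangle1_{C_u}$ and $K_\infty=\lim_{m\to\infty}K_m$ in operator norm (this limit exists and is compact, positive, self-adjoint). $\lambda_{\max}(K_\infty)$ denotes its largest eigenvalue. *)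

theory Defs
  imports "HOL-Analysis.Analysis"
begin

definition Smap :: "nat \<Rightarrow> real \<Rightarrow> real" where
  "Smap d x = (x + real d) / 3"

definition Sword :: "nat list \<Rightarrow> real \<Rightarrow> real" where
  "Sword w = foldr (\<lambda>d f. Smap d \<circ> f) w id"

definition cantor_set :: "real set" where
  "cantor_set = {x. \<exists>d::nat \<Rightarrow> nat. (\<forall>i. d i \<in> {0,2}) \<and>
                        (\<lambda>i. real (d i) / 3 ^ Suc i) sums x}"

definition cyl :: "nat list \<Rightarrow> real set" where
  "cyl w = Sword w ` cantor_set"

definition words_upto :: "nat \<Rightarrow> nat list set" where
  "words_upto m = {u. set u \<subseteq> {0,2} \<and> length u \<le> m}"

text \<open>mu_p: the unique Borel probability measure on [0,1] with
  mu_p = p mu_p o S_0^{-1} + (1-p) mu_p o S_2^{-1}.\<close>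
definition mu :: "real \<Rightarrow> real measure" where
  "mu p = (SOME M. sets M = sets borel \<and> emeasure M (space M) = 1 \<and> emeasure M {0..1} = 1 \<and>
     (\<forall>A\<in>sets borel. emeasure M A =
        ennreal p * emeasure M (Smap 0 -` A \<inter> {0..1})
      + ennreal (1 - p) * emeasure M (Smap 2 -` A \<inter> {0..1})))"

text \<open>L^2(mu_p), complex-valued (functions, equality taken almost everywhere).\<close>
definition L2 :: "real \<Rightarrow> (real \<Rightarrow> complex) set" where
  "L2 p = {f. f \<in> borel_measurable (mu p) \<and> integrable (mu p) (\<lambda>x. (cmod (f x))\<^sup>2)}"

definition L2norm :: "real \<Rightarrow> (real \<Rightarrow> complex) \<Rightarrow> real" where
  "L2norm p f = sqrt (integral\<^sup>L (mu p) (\<lambda>x. (cmod (f x))\<^sup>2))"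

definition inner_mu :: "real \<Rightarrow> (real \<Rightarrow> complex) \<Rightarrow> (real \<Rightarrow> complex) \<Rightarrow> complex" where
  "inner_mu p f g = integral\<^sup>L (mu p) (\<lambda>x. cnj (f x) * g x)"

definition Kpart :: "real \<Rightarrow> nat \<Rightarrow> (real \<Rightarrow> complex) \<Rightarrow> real \<Rightarrow> complex" where
  "Kpart p m f = (\<lambda>x. \<Sum>u\<in>words_upto m. inner_mu p (indicator (cyl u)) f * indicator (cyl u) x)"

text \<open>K_infinity = lim K_m (operator norm); applied to f it is the L^2-limit of K_m f.\<close>
definition Kinf :: "real \<Rightarrow> (real \<Rightarrow> complex) \<Rightarrow> real \<Rightarrow> complex" where
  "Kinf p f = (SOME g. g \<in> L2 p \<and> (\<lambda>m. L2norm p (\<lambda>x. Kpart p m f x - g x)) \<longlonglongrightarrow> 0)"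

definition is_eigenvalue :: "real \<Rightarrow> complex \<Rightarrow> bool" where
  "is_eigenvalue p c \<longleftrightarrow> (\<exists>f\<in>L2 p. L2norm p f \<noteq> 0 \<and> (AE x in mu p. Kinf p f x = c * f x))"

definition is_simple_eigenvalue :: "real \<Rightarrow> complex \<Rightarrow> bool" where
  "is_simple_eigenvalue p c \<longleftrightarrow> is_eigenvalue p c \<and>
     (\<forall>f\<in>L2 p. \<forall>g\<in>L2 p. L2norm p f \<noteq> 0 \<longrightarrow>
        (AE x in mu p. Kinf p f x = c * f x) \<longrightarrow> (AE x in mu p. Kinf p g x = c * g x) \<longrightarrow>
        (\<exists>a::complex. AE x in mu p. g x = a * f x))"

definition lambda_max :: "real \<Rightarrow> real" where
  "lambda_max p = (GREATEST r::real. is_eigenvalue p (complex_of_real r))"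

definition phi :: "real \<Rightarrow> complex" where
  "phi = indicator cantor_set"

text \<open>(zI - K_infinity)^{-1} phi: the L^2 solution psi of z psi - K_infinity psi = phi
  (unique for z in the resolvent set).\<close>
definition resolvent_phi :: "real \<Rightarrow> complex \<Rightarrow> real \<Rightarrow> complex" where
  "resolvent_phi p z = (SOME psi. psi \<in> L2 p \<and>
      (AE x in mu p. z * psi x - Kinf p psi x = phi x))"

definition mfun :: "real \<Rightarrow> complex \<Rightarrow> complex" where
  "mfun p z = inner_mu p phi (resolvent_phi p z)"

end

(*
  Writing f_d = f o S_d and w_0 = p, w_2 = 1 - p, the operator K = K_infinity satisfies
  (K f)_d = <phi, f> phi + w_d K f_d.  Hence lam f = K f splits into
  (lam / w_d - K) f_d = (c / w_d) phi with c = <phi, f>, and lam / w_d lies above the norm of K,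
  so f_d = (c / w_d) (lam / w_d - K)^{-1} phi.  Pairing with phi gives c = c F for
  F = m(lam / p) + m(lam / (1 - p)), which yields the equivalence and the simplicity.

  Compactness of K is not used.  If F differs from 1 at lam = ||K||, the same splitting bounds
  ||K|| - K from below, contradicting that K is positive and symmetric; so ||K|| is an eigenvalue.
  Completeness of L^2 is avoided too: K f converges uniformly with sup norm at most a constant
  times ||f||, so the Neumann series of the resolvent at phi converges uniformly.
*)

theory Submission
  imports Defs "HOL-Probability.Probability"
begin

section \<open>The self-similar measure\<close>

definition weight :: "real \<Rightarrow> nat \<Rightarrow> real" where
  "weight p d = (if d = 0 then p else 1 - p)"

text \<open>\<open>True\<close> stands for the digit 0, because \<open>bernoulli_pmf p\<close> gives
  \<open>True\<close> the probability p. The distribution of this random ternary expansion is the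
  self-similar measure.\<close>

definition coin_expansion :: "bool stream \<Rightarrow> real" where
  "coin_expansion \<omega> = (\<Sum>i. (if \<omega> !! i then 0 else 2) / 3 ^ Suc i)"

lemma summable_ternary:
  assumes "\<And>i. \<bar>a i\<bar> \<le> 2"
  shows "summable (\<lambda>i. (a i :: real) / 3 ^ Suc i)"
proof (rule summable_comparison_test')
  show "summable (\<lambda>i. (2/3) * (1/3::real) ^ i)"
    by (intro summable_mult summable_geometric) auto
  show "norm (a n / 3 ^ Suc n) \<le> (2/3) * (1/3) ^ n" for n
    using assms[of n] by (simp add: field_simps)
qed

lemma ternary_sum_bounds:
  assumes "\<And>i. 0 \<le> a i" "\<And>i. a i \<le> (2::real)"
  shows "(\<Sum>i. a i / 3 ^ Suc i) \<in> {0..1}"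
proof -
  have s: "summable (\<lambda>i. a i / 3 ^ Suc i)"
    using assms by (intro summable_ternary) (simp add: abs_le_iff order_trans[of _ 0])
  have "(\<lambda>i. (2/3) * (1/3::real) ^ i) sums ((2/3) * (1 / (1 - 1/3)))"
    by (intro sums_mult geometric_sums) auto
  then have g: "(\<lambda>i. (2/3) * (1/3::real) ^ i) sums 1" by simp
  have "(\<Sum>i. a i / 3 ^ Suc i) \<le> (\<Sum>i. (2/3) * (1/3::real) ^ i)"
    using s g by (intro suminf_le) (auto simp: sums_iff field_simps assms)
  moreover have "0 \<le> (\<Sum>i. a i / 3 ^ Suc i)"
    by (intro suminf_nonneg s) (simp add: assms)
  ultimately show ?thesis using g by (simp add: sums_iff)
qed

lemma coin_expansion_Stream:
  "coin_expansion (b ## \<omega>) = Smap (if b then 0 else 2) (coin_expansion \<omega>)"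
proof -
  have s: "summable (\<lambda>i. (if (b ## \<omega>) !! i then 0 else 2) / 3 ^ Suc i :: real)"
    and s': "summable (\<lambda>i. (if \<omega> !! i then 0 else 2) / 3 ^ Suc i :: real)"
    by (intro summable_ternary; simp)+
  have "coin_expansion (b ## \<omega>)
      = (if b then 0 else 2) / 3 + (\<Sum>i. (if \<omega> !! i then 0 else 2) / 3 ^ Suc i / 3)"
    using suminf_split_head[OF s] unfolding coin_expansion_def by (simp add: mult.commute)
  also have "(\<Sum>i. (if \<omega> !! i then 0 else 2) / 3 ^ Suc i / 3 :: real) = coin_expansion \<omega> / 3"
    unfolding coin_expansion_def by (rule suminf_divide[OF s'])
  finally show ?thesis by (simp add: Smap_def field_simps)
qed

lemma coin_expansion_measurable [measurable]:
  "coin_expansion \<in> borel_measurable (stream_space (measure_pmf q))"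
  unfolding coin_expansion_def by measurable

lemma measurable_Smap [measurable]: "Smap d \<in> borel_measurable borel"
  unfolding Smap_def by measurable

lemma Smap_in_unit: "d \<in> {0,2} \<Longrightarrow> x \<in> {0..1} \<Longrightarrow> Smap d x \<in> {0..1}"
  by (auto simp: Smap_def)

text \<open>\<open>mu p\<close> is a Hilbert choice, so its properties are available only once a
  witness is known. For independent coins, conditioning on the first one turns
  \<open>coin_expansion_Stream\<close> into the self-similarity equation.\<close>

lemma self_similar_measure_exists:
  assumes p: "0 < p" "p < 1"
  shows "\<exists>M. sets M = sets borel \<and> emeasure M (space M) = 1 \<and> emeasure M {0..1} = 1 \<and>
     (\<forall>A\<in>sets borel. emeasure M A =
        ennreal p * emeasure M (Smap 0 -` A \<inter> {0..1})
      + ennreal (1 - p) * emeasure M (Smap 2 -` A \<inter> {0..1}))"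
proof -
  define B where "B = measure_pmf (bernoulli_pmf p)"
  interpret B: prob_space B unfolding B_def by (rule prob_space_measure_pmf)
  interpret S: prob_space "stream_space B" by (rule B.prob_space_stream_space)
  have g[measurable]: "coin_expansion \<in> borel_measurable (stream_space B)"
    unfolding B_def by measurable
  have spB: "space (stream_space B) = UNIV"
    by (auto simp: space_stream_space B_def)
  define M where "M = distr (stream_space B) borel coin_expansion"
  interpret M: prob_space M unfolding M_def by (rule S.prob_space_distr) measurable
  have g01: "coin_expansion \<omega> \<in> {0..1}" for \<omega>
    unfolding coin_expansion_def by (rule ternary_sum_bounds) auto
  have em: "emeasure M A = emeasure (stream_space B) (coin_expansion -` A)" if "A \<in> sets borel" for A
    using that by (simp add: M_def emeasure_distr spB)
  show ?thesis
  proof (intro exI[of _ M] conjI ballI)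
    show "sets M = sets borel" by (simp add: M_def)
    show "emeasure M (space M) = 1" by (rule M.emeasure_space_1)
    have "coin_expansion -` {0..1} = space (stream_space B)" using g01 by (auto simp: spB)
    then show "emeasure M {0..1} = 1" by (simp add: em S.emeasure_space_1)
    fix A :: "real set" assume A[measurable]: "A \<in> sets borel"
    have pre: "coin_expansion -` (Smap d -` A \<inter> {0..1}) = coin_expansion -` (Smap d -` A)" for d
      using g01 by auto
    have ms: "Smap d -` A \<in> sets borel" for d
      using measurable_sets[OF measurable_Smap A, of d] by simp
    have "emeasure M A = emeasure (stream_space B) (coin_expansion -` A)" by (simp add: em)
    \<comment> \<open>The law of a coin stream is that of a first coin followed by an independent
      stream with the same law.\<close>
    also have "\<dots> = (\<integral>\<^sup>+b. emeasure (stream_space B) {\<omega>\<in>space (stream_space B). b ## \<omega> \<in> coin_expansion -` A} \<partial>B)"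
      using measurable_sets[OF g A] by (intro B.emeasure_stream_space) (simp add: spB)
    also have "\<dots> = (\<integral>\<^sup>+b. emeasure M (Smap (if b then 0 else 2) -` A) \<partial>B)"
      by (intro nn_integral_cong) (simp add: spB coin_expansion_Stream em ms vimage_def)
    also have "\<dots> = ennreal p * emeasure M (Smap 0 -` A) + ennreal (1 - p) * emeasure M (Smap 2 -` A)"
      using p unfolding B_def by (subst nn_integral_bernoulli_pmf) (auto simp: mult.commute)
    also have "\<dots> = ennreal p * emeasure M (Smap 0 -` A \<inter> {0..1})
      + ennreal (1 - p) * emeasure M (Smap 2 -` A \<inter> {0..1})"
      using ms by (simp add: em pre del: vimage_Int)
    finally show "emeasure M A = ennreal p * emeasure M (Smap 0 -` A \<inter> {0..1})
      + ennreal (1 - p) * emeasure M (Smap 2 -` A \<inter> {0..1})" .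
  qed
qed

section \<open>The Cantor set and its cylinders\<close>

text \<open>The finite stages of the middle-third construction. Digit sequences suit pointwise
  arguments, but compactness of \<open>cantor_set\<close>, and with it measurability, and its full
  measure are read off from these stages.\<close>

fun cantor_approx :: "nat \<Rightarrow> real set" where
  "cantor_approx 0 = {0..1}"
| "cantor_approx (Suc n) = Smap 0 ` cantor_approx n \<union> Smap 2 ` cantor_approx n"

lemma compact_cantor_approx: "compact (cantor_approx n)"
proof (induction n)
  case (Suc n)
  have "continuous_on (cantor_approx n) (Smap d)" for d
    unfolding Smap_def by (intro continuous_intros) auto
  then show ?case using Suc by (auto intro!: compact_Un compact_continuous_image)
qed simp

lemma cantor_approx_subset_unit: "cantor_approx n \<subseteq> {0..1}"
proof (induction n)
  case (Suc n)
  then show ?case using Smap_in_unit by auto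
qed simp

lemma cantor_set_Smap:
  assumes "d \<in> {0,2}" "x \<in> cantor_set" shows "Smap d x \<in> cantor_set"
proof -
  from assms obtain e where e: "\<And>i. e i \<in> {0,2}" "(\<lambda>i. real (e i) / 3 ^ Suc i) sums x"
    unfolding cantor_set_def by blast
  have "(\<lambda>i. real (case_nat d e (Suc i)) / 3 ^ Suc (Suc i)) sums (x / 3)"
    using sums_divide[OF e(2), of 3] by (simp add: mult.commute)
  then have "(\<lambda>i. real (case_nat d e i) / 3 ^ Suc i) sums (x / 3 + real d / 3)"
    by (subst (asm) sums_Suc_iff) simp
  then have "(\<lambda>i. real (case_nat d e i) / 3 ^ Suc i) sums Smap d x"
    by (simp add: Smap_def add_divide_distrib)
  moreover have "case_nat d e i \<in> {0,2}" for i using assms(1) e(1) by (cases i) auto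
  ultimately show ?thesis unfolding cantor_set_def by blast
qed

lemma cantor_set_cases:
  assumes "x \<in> cantor_set" obtains d y where "d \<in> {0,2}" "y \<in> cantor_set" "x = Smap d y"
proof -
  from assms obtain e where e: "\<And>i. e i \<in> {0,2}" "(\<lambda>i. real (e i) / 3 ^ Suc i) sums x"
    unfolding cantor_set_def by blast
  have "(\<lambda>i. real (e (Suc i)) / 3 ^ Suc (Suc i)) sums (x - real (e 0) / 3)"
    using e(2) by (subst sums_Suc_iff) simp
  from sums_mult[OF this, of 3]
  have "(\<lambda>i. real (e (Suc i)) / 3 ^ Suc i) sums (3 * x - real (e 0))"
    by (simp add: algebra_simps)
  then have "3 * x - real (e 0) \<in> cantor_set"
    unfolding cantor_set_def using e(1) by (intro CollectI exI[of _ "\<lambda>i. e (Suc i)"]) auto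
  moreover have "x = Smap (e 0) (3 * x - real (e 0))" by (simp add: Smap_def)
  ultimately show ?thesis using that e(1) by blast
qed

lemma cantor_set_subset_unit: "cantor_set \<subseteq> {0..1}"
proof
  fix x assume "x \<in> cantor_set"
  then obtain e where e: "\<And>i. e i \<in> {0,2}" "(\<lambda>i. real (e i) / 3 ^ Suc i) sums x"
    unfolding cantor_set_def by blast
  have "0 \<le> real (e i)" "real (e i) \<le> 2" for i using e(1)[of i] by auto
  from ternary_sum_bounds[of "\<lambda>i. real (e i)", OF this] show "x \<in> {0..1}"
    using e(2) by (simp add: sums_iff)
qed

text \<open>One inclusion peels off one digit per stage. For the other, the digits of a point are
  recovered as its itinerary under an expanding map.\<close>

lemma Inter_cantor_approx: "(\<Inter>n. cantor_approx n) = cantor_set"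
proof
  show "cantor_set \<subseteq> (\<Inter>n. cantor_approx n)"
  proof safe
    fix x n assume "x \<in> cantor_set"
    then show "x \<in> cantor_approx n"
    proof (induction n arbitrary: x)
      case 0 then show ?case using cantor_set_subset_unit by auto
    next
      case (Suc n)
      from Suc.prems show ?case by (rule cantor_set_cases) (use Suc.IH in auto)
    qed
  qed
next
  \<comment> \<open>\<open>T\<close> inverts both contractions at once and \<open>dig\<close> tells
    which one applies; the cut 1/2 lies in the gap between their images of the unit
    interval.\<close>
  define T where "T x = (if x \<le> 1/2 then 3 * x else 3 * x - 2)" for x :: real
  define dig where "dig x = (if x \<le> 1/2 then 0 else 2 :: nat)" for x :: real
  have T: "T x \<in> (\<Inter>n. cantor_approx n)" if "x \<in> (\<Inter>n. cantor_approx n)" for x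
  proof
    fix n
    have "x \<in> cantor_approx (Suc n)" using that by blast
    then obtain d y where y: "d \<in> {0,2}" "y \<in> cantor_approx n" "x = Smap d y" by auto
    moreover have "y \<in> {0..1}" using y cantor_approx_subset_unit by blast
    ultimately have "T x = y" by (auto simp: T_def Smap_def)
    then show "T x \<in> cantor_approx n" using y by simp
  qed
  show "(\<Inter>n. cantor_approx n) \<subseteq> cantor_set"
  proof
    fix x assume x: "x \<in> (\<Inter>n. cantor_approx n)"
    have Tn: "(T ^^ n) x \<in> (\<Inter>n. cantor_approx n)" for n
      by (induction n) (use x T in auto)
    then have unit: "(T ^^ n) x \<in> {0..1}" for n using cantor_approx.simps(1) by blast
    have step: "x = (real (dig x) + T x) / 3" for x by (simp add: dig_def T_def)
    \<comment> \<open>Exact remainder after n digits; it vanishes in the limit because the orbit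
      stays in the unit interval.\<close>
    have part: "(\<Sum>i<n. real (dig ((T ^^ i) x)) / 3 ^ Suc i) = x - (T ^^ n) x / 3 ^ n" for n
    proof (induction n)
      case (Suc n)
      have "(T ^^ n) x / 3 ^ n
          = real (dig ((T ^^ n) x)) / 3 ^ Suc n + T ((T ^^ n) x) / 3 ^ Suc n"
        by (subst step) (simp add: field_simps)
      then show ?case using Suc by simp
    qed simp
    have "(\<lambda>n. (T ^^ n) x / 3 ^ n) \<longlonglongrightarrow> 0"
    proof (rule Lim_null_comparison)
      show "(\<lambda>n. (1/3::real) ^ n) \<longlonglongrightarrow> 0" by (rule LIMSEQ_realpow_zero) auto
      show "\<forall>\<^sub>F n in sequentially. norm ((T ^^ n) x / 3 ^ n) \<le> (1/3) ^ n"
        using unit by (intro always_eventually) (auto simp: field_simps)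
    qed
    then have "(\<lambda>n. x - (T ^^ n) x / 3 ^ n) \<longlonglongrightarrow> x - 0" by (intro tendsto_intros)
    then have "(\<lambda>i. real (dig ((T ^^ i) x)) / 3 ^ Suc i) sums x"
      unfolding sums_def part by simp
    then show "x \<in> cantor_set" unfolding cantor_set_def
      by (intro CollectI exI[of _ "\<lambda>i. dig ((T ^^ i) x)"]) (auto simp: dig_def)
  qed
qed

lemma compact_cantor_set: "compact cantor_set"
proof -
  have "closed (\<Inter>n. cantor_approx n)" by (intro closed_INT) (auto intro: compact_imp_closed compact_cantor_approx)
  then show ?thesis using cantor_set_subset_unit unfolding Inter_cantor_approx
    by (metis bounded_subset bounded_closed_interval compact_eq_bounded_closed)
qed

lemma cyl_Nil: "cyl [] = cantor_set" by (simp add: cyl_def Sword_def)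

lemma cyl_Cons: "cyl (d # u) = Smap d ` cyl u"
  by (simp add: cyl_def Sword_def image_comp)

lemma compact_cyl: "compact (cyl u)"
proof (induction u)
  case Nil then show ?case by (simp add: cyl_Nil compact_cantor_set)
next
  case (Cons d u)
  have "continuous_on (cyl u) (Smap d)"
    unfolding Smap_def by (intro continuous_intros) auto
  then show ?case using Cons by (simp add: cyl_Cons compact_continuous_image)
qed

lemma cyl_measurable [measurable]: "cyl u \<in> sets borel"
  by (intro borel_closed compact_imp_closed compact_cyl)

lemma cyl_subset: "set u \<subseteq> {0,2} \<Longrightarrow> cyl u \<subseteq> cantor_set"
  by (induction u) (auto simp: cyl_Nil cyl_Cons intro: cantor_set_Smap)

lemma Smap_eq_iff:
  assumes "d \<in> {0,2}" "e \<in> {0,2}" "x \<in> {0..1}" "y \<in> {0..1}"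
  shows "Smap d x = Smap e y \<longleftrightarrow> d = e \<and> x = y"
  using assms by (auto simp: Smap_def)

text \<open>The branches are disjoint only over the unit interval: outside it they meet, as in
  \<open>Smap 0 2 = Smap 2 0\<close>.\<close>

lemma indicator_cyl_Cons_Smap:
  assumes "d \<in> {0,2}" "e \<in> {0,2}" "set u \<subseteq> {0,2}" "x \<in> {0..1}"
  shows "indicator (cyl (e # u)) (Smap d x) = (if d = e then indicator (cyl u) x else 0)"
proof -
  have "cyl u \<subseteq> {0..1}" using cyl_subset[OF assms(3)] cantor_set_subset_unit by blast
  then have "Smap d x \<in> cyl (e # u) \<longleftrightarrow> d = e \<and> x \<in> cyl u"
    unfolding cyl_Cons image_iff using Smap_eq_iff[OF assms(1,2,4)] by blast
  then show ?thesis by (simp add: indicator_def)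
qed

section \<open>Self-similarity of integrals\<close>

locale cantor_measure =
  fixes p :: real
  assumes p_pos: "0 < p" and p_less_1: "p < 1"
begin

lemma weight_pos: "0 < weight p d" and weight_le_1: "weight p d \<le> 1"
  using p_pos p_less_1 by (auto simp: weight_def)

lemma mu_props:
  "sets (mu p) = sets borel" "emeasure (mu p) (space (mu p)) = 1" "emeasure (mu p) {0..1} = 1"
  "A \<in> sets borel \<Longrightarrow> emeasure (mu p) A =
        ennreal p * emeasure (mu p) (Smap 0 -` A \<inter> {0..1})
      + ennreal (1 - p) * emeasure (mu p) (Smap 2 -` A \<inter> {0..1})"
  using someI_ex[OF self_similar_measure_exists[OF p_pos p_less_1]]
  unfolding mu_def[symmetric] by blast+

lemma sets_mu [simp, measurable_cong]: "sets (mu p) = sets borel"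
  by (rule mu_props)

lemma space_mu [simp]: "space (mu p) = UNIV"
  using sets_eq_imp_space_eq[OF sets_mu] by simp

lemma borel_measurable_mu [simp]: "borel_measurable (mu p) = borel_measurable borel"
  by (rule measurable_cong_sets) auto

sublocale prob_space "mu p"
  by standard (rule mu_props)

lemma AE_unit: "AE x in mu p. x \<in> {0..1}"
  by (subst AE_in_set_eq_1) (simp_all add: measure_def mu_props(3) del: atLeastAtMost_iff)

lemma emeasure_self_similar:
  assumes [measurable]: "A \<in> sets borel"
  shows "emeasure (mu p) A = (\<Sum>d\<in>{0,2}. ennreal (weight p d) * emeasure (mu p) (Smap d -` A))"
proof -
  have "emeasure (mu p) (Smap d -` A \<inter> {0..1}) = emeasure (mu p) (Smap d -` A)" for d
  proof (rule emeasure_eq_AE)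
    show "AE x in mu p. x \<in> Smap d -` A \<inter> {0..1} \<longleftrightarrow> x \<in> Smap d -` A"
      using AE_unit by eventually_elim auto
    show "Smap d -` A \<inter> {0..1} \<in> sets (mu p)" "Smap d -` A \<in> sets (mu p)"
      using measurable_sets[OF measurable_Smap assms, of d] by auto
  qed
  then show ?thesis using mu_props(4)[OF assms] by (simp add: weight_def)
qed

lemma nn_integral_self_similar:
  assumes "f \<in> borel_measurable borel"
  shows "(\<integral>\<^sup>+x. f x \<partial>mu p) = (\<Sum>d\<in>{0,2}. ennreal (weight p d) * (\<integral>\<^sup>+x. f (Smap d x) \<partial>mu p))"
  using assms
proof (induction rule: borel_measurable_induct)
  case (cong f g)
  then have "f = g" by auto
  with cong show ?case by simp
next
  case (set A)
  have "Smap d -` A \<in> sets (mu p)" for d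
    using measurable_sets[OF measurable_Smap, of A d] set by simp
  moreover have "(\<lambda>x. indicator A (Smap d x) :: ennreal) = indicator (Smap d -` A)" for d
    by (auto simp: indicator_def fun_eq_iff)
  ultimately have "(\<integral>\<^sup>+x. indicator A (Smap d x) \<partial>mu p) = emeasure (mu p) (Smap d -` A)" for d
    by simp
  then show ?case using set by (simp add: emeasure_self_similar)
next
  case (mult u c)
  then have [measurable]: "u \<in> borel_measurable borel" by simp
  show ?case using mult.IH
    by (simp add: nn_integral_cmult distrib_left mult.left_commute)
next
  case (add u v)
  then have [measurable]: "u \<in> borel_measurable borel" "v \<in> borel_measurable borel" by simp_all
  show ?case using add.IH
    by (simp add: nn_integral_add distrib_left ac_simps)
next
  case (seq U)
  then have [measurable]: "U i \<in> borel_measurable borel" for i by simp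
  have inc: "incseq (\<lambda>i x. U i (Smap d x))" for d
    using \<open>incseq U\<close> by (auto simp: incseq_def le_fun_def)
  have inc': "incseq (\<lambda>i. \<integral>\<^sup>+x. U i (Smap d x) \<partial>mu p)" for d
    using inc[of d] by (auto simp: incseq_def le_fun_def intro!: nn_integral_mono)
  have "(\<integral>\<^sup>+x. (SUP i. U i) x \<partial>mu p) = (SUP i. \<integral>\<^sup>+x. U i x \<partial>mu p)"
    using \<open>incseq U\<close> by (simp add: nn_integral_monotone_convergence_SUP image_comp)
  also have "\<dots> = (SUP i. \<Sum>d\<in>{0,2}. ennreal (weight p d) * (\<integral>\<^sup>+x. U i (Smap d x) \<partial>mu p))"
    using seq.IH by simp
  also have "\<dots> = (\<Sum>d\<in>{0,2}. SUP i. ennreal (weight p d) * (\<integral>\<^sup>+x. U i (Smap d x) \<partial>mu p))"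
    using inc' by (intro ennreal_SUP_sum) (auto simp: incseq_def intro!: mult_left_mono)
  also have "\<dots> = (\<Sum>d\<in>{0,2}. ennreal (weight p d) * (\<integral>\<^sup>+x. (SUP i. U i) (Smap d x) \<partial>mu p))"
    using nn_integral_monotone_convergence_SUP[OF inc]
    by (simp add: SUP_mult_left_ennreal image_comp)
  finally show ?case .
qed

lemma weight_mult_less_top_iff: "ennreal (weight p d) * X < \<top> \<longleftrightarrow> X < \<top>"
  using weight_pos[of d] by (auto simp: ennreal_mult_less_top)

lemma integrable_self_similar_iff:
  fixes f :: "real \<Rightarrow> 'a::{banach, second_countable_topology}"
  assumes [measurable]: "f \<in> borel_measurable borel"
  shows "integrable (mu p) f \<longleftrightarrow> (\<forall>d\<in>{0,2}. integrable (mu p) (\<lambda>x. f (Smap d x)))"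
  unfolding integrable_iff_bounded
  by (subst nn_integral_self_similar) (auto simp: weight_mult_less_top_iff)

lemma integral_self_similar:
  fixes f :: "real \<Rightarrow> 'a::{banach, second_countable_topology}"
  assumes "integrable (mu p) f"
  shows "(\<integral>x. f x \<partial>mu p) = (\<Sum>d\<in>{0,2}. weight p d *\<^sub>R (\<integral>x. f (Smap d x) \<partial>mu p))"
  using assms
proof (induction rule: integrable_induct)
  case (base A c)
  have [measurable]: "Smap d -` A \<in> sets borel" for d
    using measurable_sets[OF measurable_Smap, of A d] base by simp
  have int: "(\<integral>x. indicator A (Smap d x) *\<^sub>R c \<partial>mu p) = measure (mu p) (Smap d -` A) *\<^sub>R c" for d
  proof -
    have "(\<integral>x. indicator A (Smap d x) *\<^sub>R c \<partial>mu p) = (\<integral>x. indicator (Smap d -` A) x *\<^sub>R c \<partial>mu p)"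
      by (intro Bochner_Integration.integral_cong) (auto simp: indicator_def)
    then show ?thesis by (simp add: emeasure_eq_measure)
  qed
  have "ennreal (measure (mu p) A) = ennreal (\<Sum>d\<in>{0,2}. weight p d * measure (mu p) (Smap d -` A))"
    using emeasure_self_similar[of A] base weight_pos[THEN less_imp_le]
    by (simp add: emeasure_eq_measure ennreal_mult'' ennreal_plus)
  then have "measure (mu p) A = (\<Sum>d\<in>{0,2}. weight p d * measure (mu p) (Smap d -` A))"
    using weight_pos[THEN less_imp_le] by (subst (asm) ennreal_inj) auto
  then show ?case using base by (simp add: int emeasure_eq_measure scaleR_add_left)
next
  case (add f g)
  have "integrable (mu p) (\<lambda>x. f (Smap d x))" "integrable (mu p) (\<lambda>x. g (Smap d x))" if "d \<in> {0,2}" for d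
    using add(1,2)[THEN integrable_self_similar_iff[THEN iffD1, rotated]] add(1,2)[THEN borel_measurable_integrable] that
    by auto
  then show ?case using add by (simp add: scaleR_add_right)
next
  case (lim f s)
  have mf: "f \<in> borel_measurable borel" "s i \<in> borel_measurable borel" for i
    using lim(1,4)[THEN borel_measurable_integrable] by auto
  have f: "integrable (mu p) (\<lambda>x. f (Smap d x))" if "d \<in> {0,2}" for d
    using lim(4) mf integrable_self_similar_iff that by blast
  have "(\<lambda>i. \<integral>x. s i x \<partial>mu p) \<longlonglongrightarrow> (\<integral>x. f x \<partial>mu p)"
    using lim mf by (intro integral_dominated_convergence[where w="\<lambda>x. 2 * norm (f x)"]) auto
  moreover have "(\<lambda>i. \<integral>x. s i x \<partial>mu p) \<longlonglongrightarrow> (\<Sum>d\<in>{0,2}. weight p d *\<^sub>R (\<integral>x. f (Smap d x) \<partial>mu p))"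
    unfolding lim(5)
  proof (intro tendsto_intros integral_dominated_convergence)
    fix d :: nat assume d: "d \<in> {0,2}"
    show "integrable (mu p) (\<lambda>x. 2 * norm (f (Smap d x)))" using f[OF d] by auto
    show "(\<lambda>x. f (Smap d x)) \<in> borel_measurable (mu p)" "(\<lambda>x. s i (Smap d x)) \<in> borel_measurable (mu p)" for i
      using mf measurable_compose[OF measurable_Smap] by auto
  qed (use lim in auto)
  ultimately show ?case by (rule LIMSEQ_unique)
qed

text \<open>Both weights are positive, so a set is null exactly when its preimages under both
  branches are. This reassembles statements about f from the two functions x \<mapsto> f
  (\<open>Smap d x\<close>).\<close>

lemma AE_self_similar_iff:
  assumes [measurable]: "Measurable.pred borel P"
  shows "(AE x in mu p. P x) \<longleftrightarrow> (\<forall>d\<in>{0,2}. AE x in mu p. P (Smap d x))"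
proof -
  have *: "(AE x in mu p. P (f x)) \<longleftrightarrow> (\<integral>\<^sup>+x. indicator {x. \<not> P x} (f x) \<partial>mu p) = 0"
    if [measurable]: "f \<in> borel_measurable borel" for f
    by (subst nn_integral_0_iff_AE) (auto simp: indicator_def)
  show ?thesis
    using weight_pos[of 0] weight_pos[of 2]
    by (subst *[of "\<lambda>x. x"], simp, subst nn_integral_self_similar, simp)
      (simp add: *[OF measurable_Smap] ennreal_eq_0_iff)
qed

text \<open>Each stage inherits full measure from the previous one through the two branches; then a
  countable intersection is taken.\<close>

lemma AE_cantor_set: "AE x in mu p. x \<in> cantor_set"
proof -
  have ap[measurable]: "cantor_approx n \<in> sets borel" for n
    by (intro borel_closed compact_imp_closed compact_cantor_approx)
  have "AE x in mu p. x \<in> cantor_approx n" for n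
  proof (induction n)
    case 0 then show ?case using AE_unit by simp
  next
    case (Suc n)
    show ?case
    proof (subst AE_self_similar_iff, measurable, intro ballI)
      fix d :: nat assume "d \<in> {0,2}"
      then show "AE x in mu p. Smap d x \<in> cantor_approx (Suc n)"
        using Suc by (auto elim!: eventually_mono)
    qed
  qed
  then have "AE x in mu p. \<forall>n. x \<in> cantor_approx n" by (simp add: AE_all_countable)
  then show ?thesis by eventually_elim (use Inter_cantor_approx in blast)
qed

section \<open>Square-integrable functions\<close>

lemma L2_measurable: "f \<in> L2 p \<Longrightarrow> f \<in> borel_measurable borel"
  and L2_square_integrable: "f \<in> L2 p \<Longrightarrow> integrable (mu p) (\<lambda>x. (cmod (f x))\<^sup>2)"
  by (auto simp: L2_def)

lemma L2_I: "f \<in> borel_measurable borel \<Longrightarrow> integrable (mu p) (\<lambda>x. (cmod (f x))\<^sup>2) \<Longrightarrow> f \<in> L2 p"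
  by (auto simp: L2_def)

lemma L2_zero: "(\<lambda>x. 0) \<in> L2 p" by (auto simp: L2_def)

lemma L2_scale: "f \<in> L2 p \<Longrightarrow> (\<lambda>x. c * f x) \<in> L2 p"
  by (auto simp: L2_def norm_mult power_mult_distrib)

lemma measurable_cnj: "f \<in> borel_measurable M \<Longrightarrow> (\<lambda>x. cnj (f x)) \<in> borel_measurable M"
  by (rule measurable_compose[OF _ borel_measurable_continuous_onI]) (auto intro: continuous_intros)

lemma L2_mult_integrable:
  assumes "f \<in> L2 p" "g \<in> L2 p"
  shows "integrable (mu p) (\<lambda>x. cnj (f x) * g x)"
proof (rule Bochner_Integration.integrable_bound)
  show "integrable (mu p) (\<lambda>x. (cmod (f x))\<^sup>2 + (cmod (g x))\<^sup>2)"
    using assms by (auto intro: L2_square_integrable)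
  show "(\<lambda>x. cnj (f x) * g x) \<in> borel_measurable (mu p)"
    using assms[THEN L2_measurable] by (auto intro!: borel_measurable_times measurable_cnj)
  have "cmod (f x) * cmod (g x) \<le> (cmod (f x))\<^sup>2 + (cmod (g x))\<^sup>2" for x
  proof -
    have "0 \<le> cmod (f x) * cmod (g x)" by simp
    then show ?thesis using sum_squares_bound[of "cmod (f x)" "cmod (g x)"] by linarith
  qed
  then show "AE x in mu p. norm (cnj (f x) * g x) \<le> norm ((cmod (f x))\<^sup>2 + (cmod (g x))\<^sup>2)"
    by (simp add: norm_mult)
qed

lemma L2_add: 
  assumes "f \<in> L2 p" "g \<in> L2 p" shows "(\<lambda>x. f x + g x) \<in> L2 p"
proof (rule L2_I)
  show "(\<lambda>x. f x + g x) \<in> borel_measurable borel" using assms[THEN L2_measurable] by simp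
  have "integrable (mu p) (\<lambda>x. (cmod (f x))\<^sup>2 + (cmod (g x))\<^sup>2 + 2 * Re (cnj (f x) * g x))"
    using assms by (intro Bochner_Integration.integrable_add integrable_mult_right integrable_Re
      L2_square_integrable L2_mult_integrable)
  also have "(\<lambda>x. (cmod (f x))\<^sup>2 + (cmod (g x))\<^sup>2 + 2 * Re (cnj (f x) * g x)) = (\<lambda>x. (cmod (f x + g x))\<^sup>2)"
    unfolding cmod_power2 by (auto simp: power2_eq_square algebra_simps)
  finally show "integrable (mu p) (\<lambda>x. (cmod (f x + g x))\<^sup>2)" .
qed

lemma L2_diff: "f \<in> L2 p \<Longrightarrow> g \<in> L2 p \<Longrightarrow> (\<lambda>x. f x - g x) \<in> L2 p"
  using L2_add[of f "\<lambda>x. -1 * g x"] L2_scale[of g "-1"] by simp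

lemma L2_sum: "(\<And>i. i \<in> I \<Longrightarrow> f i \<in> L2 p) \<Longrightarrow> (\<lambda>x. \<Sum>i\<in>I. f i x) \<in> L2 p"
  by (induction I rule: infinite_finite_induct) (auto intro: L2_zero L2_add)

lemma L2norm_nonneg: "0 \<le> L2norm p f"
  by (simp add: L2norm_def)

lemma L2norm_square: "(L2norm p f)\<^sup>2 = (\<integral>x. (cmod (f x))\<^sup>2 \<partial>mu p)"
  by (simp add: L2norm_def)

lemma inner_self: "inner_mu p f f = complex_of_real ((L2norm p f)\<^sup>2)"
  unfolding L2norm_square inner_mu_def integral_complex_of_real[symmetric]
  by (simp add: complex_norm_square mult.commute del: of_real_power)

lemma inner_cnj: "cnj (inner_mu p f g) = inner_mu p g f"
  unfolding inner_mu_def by (subst Bochner_Integration.integral_cnj[symmetric]) (simp add: mult.commute)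

lemma inner_add_right: "\<lbrakk>h \<in> L2 p; f \<in> L2 p; g \<in> L2 p\<rbrakk> \<Longrightarrow>
    inner_mu p h (\<lambda>x. f x + g x) = inner_mu p h f + inner_mu p h g"
  using L2_mult_integrable[of h f] L2_mult_integrable[of h g]
  by (simp add: inner_mu_def distrib_left)

lemma inner_diff_right: "\<lbrakk>h \<in> L2 p; f \<in> L2 p; g \<in> L2 p\<rbrakk> \<Longrightarrow>
    inner_mu p h (\<lambda>x. f x - g x) = inner_mu p h f - inner_mu p h g"
  using L2_mult_integrable[of h f] L2_mult_integrable[of h g]
  by (simp add: inner_mu_def right_diff_distrib)

lemma inner_scale_right: "inner_mu p h (\<lambda>x. c * f x) = c * inner_mu p h f"
  by (simp add: inner_mu_def mult.left_commute)

lemma inner_sum_right: "\<lbrakk>h \<in> L2 p; \<And>i. i \<in> I \<Longrightarrow> f i \<in> L2 p\<rbrakk> \<Longrightarrow>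
    inner_mu p h (\<lambda>x. \<Sum>i\<in>I. f i x) = (\<Sum>i\<in>I. inner_mu p h (f i))"
  using L2_mult_integrable[of h] by (simp add: inner_mu_def sum_distrib_left)

lemma inner_scale_left: "inner_mu p (\<lambda>x. c * f x) h = cnj c * inner_mu p f h"
  by (subst (1 2) inner_cnj[symmetric]) (simp add: inner_scale_right)

lemma inner_cong_AE:
  assumes "AE x in mu p. f x = f' x" "AE x in mu p. g x = g' x"
    "f \<in> L2 p" "f' \<in> L2 p" "g \<in> L2 p" "g' \<in> L2 p"
  shows "inner_mu p f g = inner_mu p f' g'"
  unfolding inner_mu_def
proof (rule integral_cong_AE)
  show "AE x in mu p. cnj (f x) * g x = cnj (f' x) * g' x"
    using assms(1,2) by eventually_elim simp
qed (use assms(3-6)[THEN L2_measurable] in \<open>auto intro!: borel_measurable_times measurable_cnj\<close>)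

lemma L2norm_cong_AE:
  assumes "AE x in mu p. f x = g x" "f \<in> L2 p" "g \<in> L2 p"
  shows "L2norm p f = L2norm p g"
proof -
  have "complex_of_real ((L2norm p f)\<^sup>2) = complex_of_real ((L2norm p g)\<^sup>2)"
    using inner_cong_AE[OF assms(1,1,2,3,2,3)] by (simp only: inner_self)
  then show ?thesis using L2norm_nonneg of_real_eq_iff power2_eq_iff_nonneg by blast
qed

lemma Cauchy_Schwarz:
  assumes f: "f \<in> L2 p" and g: "g \<in> L2 p"
  shows "cmod (inner_mu p f g) \<le> L2norm p f * L2norm p g"
proof -
  have "(cmod (inner_mu p f g)) \<le> (\<integral>x. cmod (cnj (f x) * g x) \<partial>mu p)" (is "_ \<le> ?I")
    unfolding inner_mu_def by (rule integral_norm_bound)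
  moreover have "?I\<^sup>2 \<le> (L2norm p f)\<^sup>2 * (L2norm p g)\<^sup>2"
  proof -
    have I: "integrable (mu p) (\<lambda>x. cmod (cnj (f x) * g x))"
      using L2_mult_integrable[OF f g] by simp
    have nn: "(\<integral>\<^sup>+x. ennreal (cmod (h x))^2 \<partial>mu p) = ennreal ((L2norm p h)\<^sup>2)" if "h \<in> L2 p" for h
      unfolding L2norm_square
      using that by (subst nn_integral_eq_integral[symmetric]) (auto simp: ennreal_power L2_square_integrable)
    have "ennreal (?I\<^sup>2) = (\<integral>\<^sup>+x. ennreal (cmod (f x)) * ennreal (cmod (g x)) \<partial>mu p)^2"
      using nn_integral_eq_integral[OF I] by (simp add: norm_mult ennreal_mult ennreal_power)
    also have "\<dots> \<le> (\<integral>\<^sup>+x. ennreal (cmod (f x))^2 \<partial>mu p) * (\<integral>\<^sup>+x. ennreal (cmod (g x))^2 \<partial>mu p)"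
      using f[THEN L2_measurable] g[THEN L2_measurable] by (intro Cauchy_Schwarz_nn_integral) auto
    also have "\<dots> = ennreal ((L2norm p f)\<^sup>2 * (L2norm p g)\<^sup>2)"
      using nn[OF f] nn[OF g] by (simp add: ennreal_mult)
    finally show ?thesis by (subst (asm) ennreal_le_iff) auto
  qed
  ultimately have "?I \<le> L2norm p f * L2norm p g" 
    by (metis L2norm_nonneg mult_nonneg_nonneg power2_le_imp_le power_mult_distrib)
  then show ?thesis using \<open>cmod (inner_mu p f g) \<le> ?I\<close> by linarith
qed

lemma L2norm_scale: "L2norm p (\<lambda>x. c * f x) = cmod c * L2norm p f"
  by (simp add: L2norm_def norm_mult power_mult_distrib real_sqrt_mult)

lemma L2norm_add_square:
  assumes "f \<in> L2 p" "g \<in> L2 p"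
  shows "(L2norm p (\<lambda>x. f x + g x))\<^sup>2 = (L2norm p f)\<^sup>2 + 2 * Re (inner_mu p f g) + (L2norm p g)\<^sup>2"
proof -
  let ?s = "\<lambda>x. f x + g x"
  have "complex_of_real ((L2norm p ?s)\<^sup>2) = inner_mu p ?s f + inner_mu p ?s g"
    unfolding inner_self[symmetric] using assms by (intro inner_add_right L2_add)
  also have "inner_mu p ?s f = inner_mu p f f + cnj (inner_mu p f g)"
    by (subst inner_cnj[symmetric]) (use assms in \<open>simp add: inner_add_right inner_cnj\<close>)
  also have "inner_mu p ?s g = inner_mu p f g + inner_mu p g g"
    by (subst inner_cnj[symmetric]) (use assms in \<open>simp add: inner_add_right inner_cnj\<close>)
  finally have "Re (complex_of_real ((L2norm p ?s)\<^sup>2))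
      = Re (inner_mu p f f + cnj (inner_mu p f g) + (inner_mu p f g + inner_mu p g g))"
    by (rule arg_cong)
  then show ?thesis unfolding inner_self by (simp del: of_real_power)
qed

lemma L2norm_add:
  assumes f: "f \<in> L2 p" and g: "g \<in> L2 p"
  shows "L2norm p (\<lambda>x. f x + g x) \<le> L2norm p f + L2norm p g"
proof (rule power2_le_imp_le)
  have "(L2norm p (\<lambda>x. f x + g x))\<^sup>2 \<le> (L2norm p f)\<^sup>2 + 2 * (L2norm p f * L2norm p g) + (L2norm p g)\<^sup>2"
    using complex_Re_le_cmod[of "inner_mu p f g"] Cauchy_Schwarz[OF f g]
    unfolding L2norm_add_square[OF f g] by linarith
  also have "\<dots> = (L2norm p f + L2norm p g)\<^sup>2" by (simp add: power2_sum)
  finally show "(L2norm p (\<lambda>x. f x + g x))\<^sup>2 \<le> (L2norm p f + L2norm p g)\<^sup>2" .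
qed (simp add: L2norm_nonneg)

lemma L2norm_minus_commute: "L2norm p (\<lambda>x. f x - g x) = L2norm p (\<lambda>x. g x - f x)"
  by (simp add: L2norm_def norm_minus_commute)

lemma L2norm_diff_ge:
  assumes "f \<in> L2 p" and "g \<in> L2 p"
  shows "L2norm p f - L2norm p g \<le> L2norm p (\<lambda>x. f x - g x)"
  using L2norm_add[OF L2_diff[OF assms] assms(2)] by simp

lemma L2norm_triangle:
  assumes "f \<in> L2 p" "g \<in> L2 p" "h \<in> L2 p"
  shows "L2norm p (\<lambda>x. f x - h x) \<le> L2norm p (\<lambda>x. f x - g x) + L2norm p (\<lambda>x. g x - h x)"
  using L2norm_add[OF L2_diff[OF assms(1,2)] L2_diff[OF assms(2,3)]] by simp

lemma L2norm_eq_0_iff: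
  assumes "f \<in> L2 p" shows "L2norm p f = 0 \<longleftrightarrow> (AE x in mu p. f x = 0)"
  using integral_nonneg_eq_0_iff_AE[OF L2_square_integrable[OF assms]] by (simp add: L2norm_def)

lemma L2norm_diff_eq_0_iff:
  assumes "f \<in> L2 p" "g \<in> L2 p"
  shows "L2norm p (\<lambda>x. f x - g x) = 0 \<longleftrightarrow> (AE x in mu p. f x = g x)"
  using L2norm_eq_0_iff[OF L2_diff[OF assms]] by simp

text \<open>For a probability measure the sup norm dominates the L2 norm; uniform estimates become
  norm estimates through this.\<close>

lemma L2_bounded:
  assumes m[measurable]: "f \<in> borel_measurable borel" and b: "\<And>x. cmod (f x) \<le> B"
  shows "f \<in> L2 p" "L2norm p f \<le> B"
proof -
  have B: "0 \<le> B" using b[of 0] norm_ge_zero order_trans by blast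
  have sq: "(cmod (f x))\<^sup>2 \<le> B\<^sup>2" for x using b by (intro power_mono) auto
  show L: "f \<in> L2 p"
    using sq by (intro L2_I integrable_const_bound[where B="B\<^sup>2"]) auto
  have "(\<integral>x. (cmod (f x))\<^sup>2 \<partial>mu p) \<le> (\<integral>x. B\<^sup>2 \<partial>mu p)"
    using L by (intro integral_mono L2_square_integrable sq) auto
  then have "(L2norm p f)\<^sup>2 \<le> B\<^sup>2" using prob_space by (simp add: L2norm_square)
  then show "L2norm p f \<le> B" using B power2_le_imp_le by blast
qed

lemma L2_Smap_iff:
  assumes [measurable]: "f \<in> borel_measurable borel"
  shows "f \<in> L2 p \<longleftrightarrow> (\<forall>d\<in>{0,2}. (\<lambda>x. f (Smap d x)) \<in> L2 p)"
  using integrable_self_similar_iff[of "\<lambda>x. (cmod (f x))\<^sup>2"] by (auto simp: L2_def)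

lemma L2_Smap: "f \<in> L2 p \<Longrightarrow> d \<in> {0,2} \<Longrightarrow> (\<lambda>x. f (Smap d x)) \<in> L2 p"
  using L2_Smap_iff L2_measurable by blast

lemma inner_self_similar:
  assumes "f \<in> L2 p" "g \<in> L2 p"
  shows "inner_mu p f g = (\<Sum>d\<in>{0,2}. weight p d * inner_mu p (\<lambda>x. f (Smap d x)) (\<lambda>x. g (Smap d x)))"
  unfolding inner_mu_def using integral_self_similar[OF L2_mult_integrable[OF assms]]
  by (simp add: scaleR_conv_of_real)

lemma L2norm_self_similar:
  assumes "f \<in> L2 p"
  shows "(L2norm p f)\<^sup>2 = (\<Sum>d\<in>{0,2}. weight p d * (L2norm p (\<lambda>x. f (Smap d x)))\<^sup>2)"
  unfolding L2norm_square using integral_self_similar[OF L2_square_integrable[OF assms]] by simp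

end

section \<open>The operator\<close>

text \<open>Grouping words by exact length turns K_m into a partial sum of a series whose n-th term
  decays geometrically, and removing the first letter leads from length \<open>Suc n\<close> to
  length n.\<close>

definition words :: "nat \<Rightarrow> nat list set" where
  "words n = {u. set u \<subseteq> {0,2} \<and> length u = n}"

lemma finite_words: "finite (words n)"
  unfolding words_def by (rule finite_lists_length_eq) simp

lemma words_0: "words 0 = {[]}" by (auto simp: words_def)

lemma sum_words_Suc:
  "(\<Sum>u\<in>words (Suc n). g u) = (\<Sum>d\<in>{0,2}. \<Sum>u\<in>words n. g (d # u))"
proof -
  have "bij_betw (\<lambda>(d,u). d # u) ({0,2} \<times> words n) (words (Suc n))"
    unfolding bij_betw_def
  proof
    show "(\<lambda>(d,u). d # u) ` ({0,2} \<times> words n) = words (Suc n)"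
      by (force simp: words_def length_Suc_conv image_iff)
  qed (auto simp: inj_on_def)
  then show ?thesis
    by (subst sum.reindex_bij_betw[symmetric]) (auto simp: sum.cartesian_product case_prod_unfold)
qed

lemma words_upto_eq: "words_upto m = (\<Union>n<Suc m. words n)"
  by (auto simp: words_upto_def words_def)

context cantor_measure
begin

text \<open>The Weierstrass test, with convergence also in L2. It serves both the series defining
  \<open>K\<close> and the Neumann series.\<close>

lemma L2_series:
  assumes [measurable]: "\<And>n. f n \<in> borel_measurable borel"
    and b: "\<And>n x. cmod (f n x) \<le> a n" and a: "summable a"
  shows "(\<lambda>x. \<Sum>n. f n x) \<in> L2 p" "cmod (\<Sum>n. f n x) \<le> (\<Sum>n. a n)"
    "(\<lambda>m. L2norm p (\<lambda>x. (\<Sum>n<m. f n x) - (\<Sum>n. f n x))) \<longlonglongrightarrow> 0"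
proof -
  have sn: "summable (\<lambda>n. cmod (f n x))" for x
    by (rule summable_comparison_test'[OF a]) (simp add: b)
  then have s: "summable (\<lambda>n. f n x)" for x by (rule summable_norm_cancel)
  have bd: "cmod (\<Sum>n. f n x) \<le> (\<Sum>n. a n)" for x
    using summable_norm[OF sn] suminf_le[OF b sn a] by (rule order_trans)
  then show "cmod (\<Sum>n. f n x) \<le> (\<Sum>n. a n)" .
  show "(\<lambda>x. \<Sum>n. f n x) \<in> L2 p" by (rule L2_bounded[OF _ bd]) measurable
  have tail: "cmod ((\<Sum>n<m. f n x) - (\<Sum>n. f n x)) \<le> (\<Sum>n. a n) - (\<Sum>n<m. a n)" for m x
  proof -
    have "(\<Sum>n<m. f n x) - (\<Sum>n. f n x) = - (\<Sum>n. f (n + m) x)"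
      using suminf_split_initial_segment[OF s, of x m] by simp
    then have "cmod ((\<Sum>n<m. f n x) - (\<Sum>n. f n x)) = cmod (\<Sum>n. f (n + m) x)" by simp
    also have "\<dots> \<le> (\<Sum>n. cmod (f (n + m) x))"
      using sn[of x] by (intro summable_norm) (subst summable_iff_shift)
    also have "\<dots> \<le> (\<Sum>n. a (n + m))"
      using sn[of x] a by (intro suminf_le b) (subst summable_iff_shift, assumption)+
    also have "\<dots> = (\<Sum>n. a n) - (\<Sum>n<m. a n)"
      using suminf_split_initial_segment[OF a, of m] by simp
    finally show ?thesis .
  qed
  show "(\<lambda>m. L2norm p (\<lambda>x. (\<Sum>n<m. f n x) - (\<Sum>n. f n x))) \<longlonglongrightarrow> 0"
  proof (rule Lim_null_comparison)
    have "(\<lambda>m. (\<Sum>n. a n) - (\<Sum>n<m. a n)) \<longlonglongrightarrow> (\<Sum>n. a n) - (\<Sum>n. a n)"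
      by (intro tendsto_intros summable_LIMSEQ a)
    then show "(\<lambda>m. (\<Sum>n. a n) - (\<Sum>n<m. a n)) \<longlonglongrightarrow> 0" by simp
    show "\<forall>\<^sub>F m in sequentially. norm (L2norm p (\<lambda>x. (\<Sum>n<m. f n x) - (\<Sum>n. f n x)))
        \<le> (\<Sum>n. a n) - (\<Sum>n<m. a n)"
      by (intro always_eventually allI) (simp add: L2norm_nonneg L2_bounded(2)[OF _ tail])
  qed
qed

lemma inner_tendsto:
  assumes "g \<in> L2 p" "\<And>n. f n \<in> L2 p" "h \<in> L2 p" "(\<lambda>n. L2norm p (\<lambda>x. f n x - h x)) \<longlonglongrightarrow> 0"
  shows "(\<lambda>n. inner_mu p g (f n)) \<longlonglongrightarrow> inner_mu p g h"
proof (rule LIM_zero_cancel, rule Lim_null_comparison)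
  show "\<forall>\<^sub>F n in sequentially. norm (inner_mu p g (f n) - inner_mu p g h)
      \<le> L2norm p g * L2norm p (\<lambda>x. f n x - h x)"
    using assms(1-3) by (intro always_eventually allI)
      (simp add: inner_diff_right[symmetric] Cauchy_Schwarz L2_diff)
  show "(\<lambda>n. L2norm p g * L2norm p (\<lambda>x. f n x - h x)) \<longlonglongrightarrow> 0"
    using tendsto_mult_right_zero[OF assms(4)] .
qed

section \<open>Cylinder indicators and the constant function \<open>phi\<close>\<close>

abbreviation cyl_ind :: "nat list \<Rightarrow> real \<Rightarrow> complex" where
  "cyl_ind u \<equiv> indicator (cyl u)"

lemma cyl_ind_L2: "cyl_ind u \<in> L2 p" "L2norm p (cyl_ind u) \<le> 1"
  by (auto intro!: L2_bounded[where B=1] simp: indicator_def)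

lemma phi_L2: "phi \<in> L2 p" and L2norm_phi_le: "L2norm p phi \<le> 1"
  using cyl_ind_L2[of "[]"] by (simp_all add: phi_def cyl_Nil)

lemma phi_Smap: "d \<in> {0,2} \<Longrightarrow> x \<in> cantor_set \<Longrightarrow> phi (Smap d x) = 1"
  by (simp add: phi_def cantor_set_Smap)

lemma AE_phi: "AE x in mu p. phi x = 1"
  using AE_cantor_set by eventually_elim (simp add: phi_def)

lemma inner_phi_phi: "inner_mu p phi phi = 1"
proof -
  have "inner_mu p phi phi = inner_mu p (\<lambda>x. 1) (\<lambda>x. 1)"
    using AE_phi phi_L2 by (intro inner_cong_AE) (auto intro: L2_bounded(1)[where B=1])
  then show ?thesis using prob_space by (simp add: inner_mu_def)
qed

text \<open>Up to null sets \<open>phi\<close> is 1, hence unchanged by composition with either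
  branch.\<close>

lemma inner_phi_Smap:
  assumes "f \<in> L2 p"
  shows "inner_mu p phi f = (\<Sum>d\<in>{0,2}. weight p d * inner_mu p phi (\<lambda>x. f (Smap d x)))"
proof -
  have "inner_mu p (\<lambda>x. phi (Smap d x)) (\<lambda>x. f (Smap d x)) = inner_mu p phi (\<lambda>x. f (Smap d x))"
    if d: "d \<in> {0,2}" for d
  proof (rule inner_cong_AE)
    show "AE x in mu p. phi (Smap d x) = phi x"
      using AE_phi AE_cantor_set by eventually_elim (use phi_Smap d in simp)
  qed (use assms d phi_L2 L2_Smap in auto)
  then show ?thesis by (simp add: inner_self_similar[OF phi_L2 assms])
qed

text \<open>The other branch misses the cylinder, so only the summand of d survives, with its
  weight.\<close>

lemma inner_cyl_ind_Cons:
  assumes d: "d \<in> {0,2}" and u: "set u \<subseteq> {0,2}" and f: "f \<in> L2 p"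
  shows "inner_mu p (cyl_ind (d # u)) f = weight p d * inner_mu p (cyl_ind u) (\<lambda>x. f (Smap d x))"
proof -
  have "inner_mu p (\<lambda>x. cyl_ind (d # u) (Smap e x)) (\<lambda>x. f (Smap e x))
      = inner_mu p (\<lambda>x. if e = d then cyl_ind u x else 0) (\<lambda>x. f (Smap e x))"
    if e: "e \<in> {0,2}" for e
  proof (rule inner_cong_AE)
    show "AE x in mu p. cyl_ind (d # u) (Smap e x) = (if e = d then cyl_ind u x else 0)"
      using AE_unit by eventually_elim (rule indicator_cyl_Cons_Smap[OF e d u])
    show "(\<lambda>x. if e = d then cyl_ind u x else 0) \<in> L2 p"
      by (cases "e = d") (simp_all add: cyl_ind_L2 L2_zero)
  qed (use f e cyl_ind_L2 L2_Smap in auto)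
  then have "inner_mu p (cyl_ind (d # u)) f = (\<Sum>e\<in>{0,2}. weight p e *
      inner_mu p (\<lambda>x. if e = d then cyl_ind u x else 0) (\<lambda>x. f (Smap e x)))"
    by (simp add: inner_self_similar[OF cyl_ind_L2(1) f])
  also have "\<dots> = weight p d * inner_mu p (cyl_ind u) (\<lambda>x. f (Smap d x))"
    using d by (auto simp: inner_mu_def)
  finally show ?thesis .
qed

text \<open>The share of the words of length n in the operator. Cylinders of equal length are
  disjoint, so at most one summand is nonzero at each point.\<close>

definition level :: "nat \<Rightarrow> (real \<Rightarrow> complex) \<Rightarrow> real \<Rightarrow> complex" where
  "level n f x = (\<Sum>u\<in>words n. inner_mu p (cyl_ind u) f * cyl_ind u x)"

lemma level_0: "level 0 f x = inner_mu p phi f * phi x"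
  by (simp add: level_def words_0 cyl_Nil phi_def)

text \<open>Removing the first letter costs one factor \<open>weight p d\<close>. Summed over n,
  this becomes the self-similarity \<open>K_Smap\<close> of the operator.\<close>

lemma level_Suc_Smap:
  assumes d: "d \<in> {0,2}" and f: "f \<in> L2 p" and x: "x \<in> {0..1}"
  shows "level (Suc n) f (Smap d x) = weight p d * level n (\<lambda>x. f (Smap d x)) x"
proof -
  have "level (Suc n) f (Smap d x) = (\<Sum>e\<in>{0,2}. \<Sum>u\<in>words n.
      inner_mu p (cyl_ind (e # u)) f * cyl_ind (e # u) (Smap d x))"
    unfolding level_def by (rule sum_words_Suc)
  also have "\<dots> = (\<Sum>e\<in>{0,2}. if d = e then \<Sum>u\<in>words n.
      inner_mu p (cyl_ind (e # u)) f * cyl_ind u x else 0)"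
    using x d by (intro sum.cong refl) (auto simp: words_def indicator_cyl_Cons_Smap)
  also have "\<dots> = (\<Sum>u\<in>words n. inner_mu p (cyl_ind (d # u)) f * cyl_ind u x)"
    using d by auto
  also have "\<dots> = weight p d * level n (\<lambda>x. f (Smap d x)) x"
    unfolding level_def sum_distrib_left
    by (intro sum.cong refl) (simp add: words_def inner_cyl_ind_Cons[OF d _ f])
  finally show ?thesis .
qed

lemma level_outside: "x \<notin> cantor_set \<Longrightarrow> level n f x = 0"
  unfolding level_def words_def using cyl_subset by (intro sum.neutral) (auto simp: indicator_def)

lemma level_measurable [measurable]: "level n f \<in> borel_measurable borel"
  unfolding level_def by measurable

text \<open>A cylinder of level n has mass at most \<open>max p (1 - p) ^ n\<close>; the square root
  appears because Cauchy-Schwarz sees the L2 norm of its indicator.\<close>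

definition decay :: real where "decay = sqrt (max p (1 - p))"

lemma decay_bounds: "0 < decay" "decay < 1" "weight p d \<le> decay\<^sup>2"
  using p_pos p_less_1 by (auto simp: decay_def weight_def)

text \<open>A single branch gives w ||f_d||^2 \<le> ||f||^2, so w ||f_d|| is at most sqrt(w) ||f||,
  and sqrt(w) \<le> \<open>decay\<close>.\<close>

lemma weight_L2norm_Smap_le:
  assumes "f \<in> L2 p" "d \<in> {0,2}"
  shows "weight p d * L2norm p (\<lambda>x. f (Smap d x)) \<le> decay * L2norm p f"
proof (rule power2_le_imp_le)
  let ?a = "\<lambda>e. weight p e * (L2norm p (\<lambda>x. f (Smap e x)))\<^sup>2"
  have "?a d \<le> (\<Sum>e\<in>{0,2}. ?a e)"
    using assms(2) weight_pos[THEN less_imp_le] by (intro member_le_sum) auto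
  then have *: "?a d \<le> (L2norm p f)\<^sup>2" using L2norm_self_similar[OF assms(1)] by simp
  have "(weight p d * L2norm p (\<lambda>x. f (Smap d x)))\<^sup>2 = weight p d * ?a d"
    by (simp add: power_mult_distrib power2_eq_square)
  also have "\<dots> \<le> decay\<^sup>2 * (L2norm p f)\<^sup>2"
    using * decay_bounds(3) weight_pos[of d] by (intro mult_mono) auto
  finally show "(weight p d * L2norm p (\<lambda>x. f (Smap d x)))\<^sup>2 \<le> (decay * L2norm p f)\<^sup>2"
    by (simp add: power_mult_distrib)
qed (use decay_bounds L2norm_nonneg in simp)

text \<open>Induction along the digits of x: each digit contributes one factor \<open>decay\<close>
  by the preceding estimate. The bound is uniform in x.\<close>

lemma level_bound:
  assumes "f \<in> L2 p" shows "cmod (level n f x) \<le> decay ^ n * L2norm p f"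
proof (cases "x \<in> cantor_set")
  case False
  then show ?thesis using decay_bounds L2norm_nonneg by (simp add: level_outside)
next
  case True
  then show ?thesis using assms
  proof (induction n arbitrary: x f)
    case 0
    have "cmod (inner_mu p phi f) \<le> 1 * L2norm p f"
      using Cauchy_Schwarz[OF phi_L2 0(2)] mult_right_mono[OF L2norm_phi_le L2norm_nonneg]
      by (rule order_trans)
    then show ?case using 0 by (simp add: level_0 phi_def)
  next
    case (Suc n)
    from Suc.prems(1) obtain d y where y: "d \<in> {0,2}" "y \<in> cantor_set" "x = Smap d y"
      by (rule cantor_set_cases)
    then have "level (Suc n) f x = weight p d * level n (\<lambda>x. f (Smap d x)) y"
      using cantor_set_subset_unit Suc.prems by (simp add: level_Suc_Smap subset_iff)
    then have "cmod (level (Suc n) f x) = weight p d * cmod (level n (\<lambda>x. f (Smap d x)) y)"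
      using weight_pos[of d] by (simp add: norm_mult)
    also have "\<dots> \<le> weight p d * (decay ^ n * L2norm p (\<lambda>x. f (Smap d x)))"
      using Suc.IH[OF y(2) L2_Smap[OF Suc.prems(2) y(1)]] weight_pos[of d] by simp
    also have "\<dots> = decay ^ n * (weight p d * L2norm p (\<lambda>x. f (Smap d x)))" by simp
    also have "\<dots> \<le> decay ^ n * (decay * L2norm p f)"
      using weight_L2norm_Smap_le[OF Suc.prems(2) y(1)] decay_bounds by (intro mult_left_mono) auto
    finally show ?case by (simp add: mult_ac)
  qed
qed

lemma level_L2: "f \<in> L2 p \<Longrightarrow> level n f \<in> L2 p"
  by (rule L2_bounded(1)[OF level_measurable level_bound])

lemma summable_decay: "summable (\<lambda>n. decay ^ n * c)"
  using decay_bounds by (intro summable_mult2 summable_geometric) auto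

lemma summable_level: "f \<in> L2 p \<Longrightarrow> summable (\<lambda>n. level n f x)"
  by (rule summable_comparison_test'[OF summable_decay level_bound])

text \<open>A concrete representative of \<open>Kinf p f\<close>, which is determined only up to
  null sets. For f in \<open>L2 p\<close> the series converges at every point, so identities for
  \<open>K\<close> can be checked pointwise.\<close>

definition K :: "(real \<Rightarrow> complex) \<Rightarrow> real \<Rightarrow> complex" where
  "K f x = (\<Sum>n. level n f x)"

text \<open>The constant \<open>1 / (1 - decay)\<close> is the sum of the geometric series from
  \<open>level_bound\<close>. The sup bound is what makes iterates of \<open>K\<close> controllable
  uniformly in x.\<close>

lemma
  assumes "f \<in> L2 p"
  shows K_L2: "K f \<in> L2 p"
    and K_bound: "cmod (K f x) \<le> 1 / (1 - decay) * L2norm p f"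
    and K_limit: "(\<lambda>m. L2norm p (\<lambda>x. (\<Sum>n<m. level n f x) - K f x)) \<longlonglongrightarrow> 0"
proof -
  note S = L2_series[of "\<lambda>n. level n f", OF level_measurable level_bound[OF assms] summable_decay, folded K_def]
  show "K f \<in> L2 p" using S(1) by (simp add: K_def[abs_def])
  show "(\<lambda>m. L2norm p (\<lambda>x. (\<Sum>n<m. level n f x) - K f x)) \<longlonglongrightarrow> 0" by (rule S(3))
  have "(\<lambda>n. decay ^ n * L2norm p f) sums (1 / (1 - decay) * L2norm p f)"
    using decay_bounds by (intro sums_mult2 geometric_sums) auto
  then show "cmod (K f x) \<le> 1 / (1 - decay) * L2norm p f"
    using S(2)[of x] by (simp add: sums_iff)
qed

lemma Kpart_eq: "Kpart p m f x = (\<Sum>n<Suc m. level n f x)"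
  unfolding Kpart_def level_def words_upto_eq
  by (rule sum.UNION_disjoint) (use finite_words in \<open>auto simp: words_def\<close>)

text \<open>\<open>K f\<close> witnesses that the choice in \<open>Kinf\<close> has a candidate, and
  two L2 limits of the same sequence agree almost everywhere.\<close>

lemma Kinf_AE:
  assumes f: "f \<in> L2 p"
  shows "AE x in mu p. Kinf p f x = K f x"
proof -
  have lim: "(\<lambda>m. L2norm p (\<lambda>x. Kpart p m f x - K f x)) \<longlonglongrightarrow> 0"
    unfolding Kpart_eq using K_limit[OF f] by (rule LIMSEQ_Suc)
  have "Kinf p f \<in> L2 p \<and> (\<lambda>m. L2norm p (\<lambda>x. Kpart p m f x - Kinf p f x)) \<longlonglongrightarrow> 0"
    unfolding Kinf_def by (rule someI[of _ "K f"]) (use lim K_L2[OF f] in blast)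
  then have k: "Kinf p f \<in> L2 p"
    and lim': "(\<lambda>m. L2norm p (\<lambda>x. Kpart p m f x - Kinf p f x)) \<longlonglongrightarrow> 0" by auto
  have part: "(\<lambda>x. Kpart p m f x) \<in> L2 p" for m
    unfolding Kpart_eq by (intro L2_sum level_L2 f)
  have "(\<lambda>m. L2norm p (\<lambda>x. Kpart p m f x - Kinf p f x) + L2norm p (\<lambda>x. Kpart p m f x - K f x)) \<longlonglongrightarrow> 0 + 0"
    by (intro tendsto_add lim lim')
  moreover have "L2norm p (\<lambda>x. Kinf p f x - K f x)
     \<le> L2norm p (\<lambda>x. Kpart p m f x - Kinf p f x) + L2norm p (\<lambda>x. Kpart p m f x - K f x)" for m
    using L2norm_triangle[OF k part K_L2[OF f]] L2norm_minus_commute by metis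
  ultimately have "L2norm p (\<lambda>x. Kinf p f x - K f x) \<le> 0 + 0"
    by (intro LIMSEQ_le_const) auto
  then have "L2norm p (\<lambda>x. Kinf p f x - K f x) = 0" using L2norm_nonneg by (simp add: order_antisym)
  then show "AE x in mu p. Kinf p f x = K f x"
    using L2norm_diff_eq_0_iff[OF k K_L2[OF f]] by simp
qed

lemma level_diff: "\<lbrakk>f \<in> L2 p; g \<in> L2 p\<rbrakk> \<Longrightarrow> level n (\<lambda>x. f x - g x) x = level n f x - level n g x"
  by (simp add: level_def inner_diff_right cyl_ind_L2 left_diff_distrib sum_subtractf)

lemma level_add: "\<lbrakk>f \<in> L2 p; g \<in> L2 p\<rbrakk> \<Longrightarrow> level n (\<lambda>x. f x + g x) x = level n f x + level n g x"
  by (simp add: level_def inner_add_right cyl_ind_L2 distrib_right sum.distrib)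

lemma level_scale: "level n (\<lambda>x. c * f x) x = c * level n f x"
  by (simp add: level_def inner_scale_right sum_distrib_left mult.assoc)

lemma K_diff: "\<lbrakk>f \<in> L2 p; g \<in> L2 p\<rbrakk> \<Longrightarrow> K (\<lambda>x. f x - g x) = (\<lambda>x. K f x - K g x)"
  by (simp add: fun_eq_iff K_def level_diff suminf_diff summable_level)

lemma K_add: "\<lbrakk>f \<in> L2 p; g \<in> L2 p\<rbrakk> \<Longrightarrow> K (\<lambda>x. f x + g x) = (\<lambda>x. K f x + K g x)"
  by (simp add: fun_eq_iff K_def level_add suminf_add summable_level)

lemma K_scale: "f \<in> L2 p \<Longrightarrow> K (\<lambda>x. c * f x) = (\<lambda>x. c * K f x)"
  by (simp add: fun_eq_iff K_def level_scale suminf_mult summable_level)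

text \<open>\<open>K\<close> sees f only through integrals against indicators, hence equality at
  every point and not merely almost everywhere.\<close>

lemma K_cong_AE:
  assumes "AE x in mu p. f x = g x" "f \<in> L2 p" "g \<in> L2 p" shows "K f = K g"
proof -
  have "inner_mu p (cyl_ind u) f = inner_mu p (cyl_ind u) g" for u
    using assms by (intro inner_cong_AE) (auto simp: cyl_ind_L2)
  then show ?thesis by (simp add: K_def[abs_def] level_def)
qed

text \<open>The empty word yields the constant, since \<open>phi\<close> is 1 on the Cantor set; the
  longer words sum to the second term by \<open>level_Suc_Smap\<close>.\<close>

lemma K_Smap:
  assumes d: "d \<in> {0,2}" and f: "f \<in> L2 p" and x: "x \<in> cantor_set"
  shows "K f (Smap d x) = inner_mu p phi f + weight p d * K (\<lambda>x. f (Smap d x)) x"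
proof -
  have x': "x \<in> {0..1}" using x cantor_set_subset_unit by blast
  have "K f (Smap d x) = (\<Sum>n. level (Suc n) f (Smap d x)) + level 0 f (Smap d x)"
    unfolding K_def using suminf_split_head[OF summable_level[OF f]] by simp
  also have "level 0 f (Smap d x) = inner_mu p phi f"
    using d x by (simp add: level_0 phi_Smap)
  also have "(\<Sum>n. level (Suc n) f (Smap d x)) = weight p d * K (\<lambda>x. f (Smap d x)) x"
    unfolding K_def level_Suc_Smap[OF d f x']
    by (rule suminf_mult[OF summable_level[OF L2_Smap[OF f d]]])
  finally show ?thesis by simp
qed

section \<open>Symmetry and positivity of the operator\<close>

lemma inner_level: "\<lbrakk>f \<in> L2 p; g \<in> L2 p\<rbrakk> \<Longrightarrow>
  inner_mu p g (level n f) = (\<Sum>u\<in>words n. inner_mu p (cyl_ind u) f * inner_mu p g (cyl_ind u))"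
  unfolding level_def[abs_def]
  by (simp add: inner_sum_right L2_scale cyl_ind_L2 inner_scale_right)

lemma inner_level_symmetric:
  assumes "f \<in> L2 p" "g \<in> L2 p" shows "inner_mu p g (level n f) = inner_mu p (level n g) f"
proof -
  have "inner_mu p (level n g) f = cnj (inner_mu p f (level n g))" by (simp only: inner_cnj)
  then show ?thesis using assms by (simp add: inner_level inner_cnj mult.commute)
qed

text \<open>The quadratic form of a level is the sum of |<1_u, f>|^2 over its words.\<close>

lemma inner_level_nonneg:
  assumes "f \<in> L2 p" shows "0 \<le> Re (inner_mu p f (level n f))"
proof -
  have "inner_mu p (cyl_ind u) f * inner_mu p f (cyl_ind u)
      = complex_of_real ((cmod (inner_mu p (cyl_ind u) f))\<^sup>2)" for u
    by (simp only: complex_norm_square inner_cnj)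
  then show ?thesis using assms by (simp add: inner_level sum_nonneg del: of_real_power)
qed

lemma inner_K_tendsto:
  assumes f: "f \<in> L2 p" and g: "g \<in> L2 p"
  shows "(\<lambda>m. \<Sum>n<m. inner_mu p g (level n f)) \<longlonglongrightarrow> inner_mu p g (K f)"
  using inner_tendsto[OF g L2_sum[OF level_L2[OF f]] K_L2[OF f] K_limit[OF f]]
  by (simp add: inner_sum_right g level_L2 f)

lemma K_symmetric:
  assumes f: "f \<in> L2 p" and g: "g \<in> L2 p"
  shows "inner_mu p g (K f) = inner_mu p (K g) f"
proof -
  have "(\<lambda>m. cnj (\<Sum>n<m. inner_mu p f (level n g))) \<longlonglongrightarrow> cnj (inner_mu p f (K g))"
    by (intro tendsto_cnj inner_K_tendsto f g)
  then have "(\<lambda>m. \<Sum>n<m. inner_mu p g (level n f)) \<longlonglongrightarrow> inner_mu p (K g) f"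
    by (simp add: inner_cnj inner_level_symmetric[OF f g])
  then show ?thesis using inner_K_tendsto[OF f g] LIMSEQ_unique by blast
qed

text \<open>The partial sums increase to their limit. The case m = 0 is positivity of
  \<open>K\<close>; the case m = 1 at \<open>phi\<close> keeps the empty word and gives
  \<open>inner_phi_K_phi\<close>.\<close>

lemma inner_level_sum_le_K:
  assumes f: "f \<in> L2 p" shows "(\<Sum>n<m. Re (inner_mu p f (level n f))) \<le> Re (inner_mu p f (K f))"
proof -
  have "(\<lambda>m. Re (\<Sum>n<m. inner_mu p f (level n f))) \<longlonglongrightarrow> Re (inner_mu p f (K f))"
    by (intro tendsto_Re inner_K_tendsto f)
  then have lim: "(\<lambda>m. \<Sum>n<m. Re (inner_mu p f (level n f))) \<longlonglongrightarrow> Re (inner_mu p f (K f))" by simp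
  show ?thesis
    by (rule incseq_le[OF _ lim]) (auto simp: incseq_def intro!: sum_mono2 inner_level_nonneg f)
qed

lemma K_positive: "f \<in> L2 p \<Longrightarrow> 0 \<le> Re (inner_mu p f (K f))"
  using inner_level_sum_le_K[of f 0] by simp

lemma inner_phi_K_phi: "1 \<le> Re (inner_mu p phi (K phi))"
proof -
  have "inner_mu p phi (level 0 phi) = 1"
    unfolding level_0[abs_def] by (simp add: inner_scale_right inner_phi_phi)
  then show ?thesis using inner_level_sum_le_K[OF phi_L2, of 1] by simp
qed

section \<open>The operator norm\<close>

definition opnorm :: real where
  "opnorm = (SUP f\<in>{f \<in> L2 p. L2norm p f \<le> 1}. L2norm p (K f))"

lemma opnorm_bdd: "bdd_above ((\<lambda>f. L2norm p (K f)) ` {f \<in> L2 p. L2norm p f \<le> 1})"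
proof (rule bdd_aboveI2)
  fix f assume "f \<in> {f \<in> L2 p. L2norm p f \<le> 1}"
  then have f: "f \<in> L2 p" "L2norm p f \<le> 1" by auto
  have "L2norm p (K f) \<le> 1 / (1 - decay) * L2norm p f"
    using L2_bounded(2)[OF L2_measurable[OF K_L2] K_bound] f by blast
  also have "\<dots> \<le> 1 / (1 - decay) * 1"
    using f decay_bounds by (intro mult_left_mono) auto
  finally show "L2norm p (K f) \<le> 1 / (1 - decay)" by simp
qed

lemma opnorm_K:
  assumes f: "f \<in> L2 p" shows "L2norm p (K f) \<le> opnorm * L2norm p f"
\<comment> \<open>\<open>L2norm\<close> is only a seminorm on functions: a null f cannot be
  normalised, but \<open>K\<close> sends it to the zero function.\<close>
proof (cases "L2norm p f = 0")
  case True
  then have "AE x in mu p. f x = 0" using L2norm_eq_0_iff[OF f] by simp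
  then have "K f = K (\<lambda>x. 0 * f x)" using f by (intro K_cong_AE) (auto simp: L2_zero)
  then have "K f = (\<lambda>x. 0)" using K_scale[OF f, of 0] by simp
  then show ?thesis using True by (simp add: L2norm_def)
next
  case False
  then have n: "0 < L2norm p f" using L2norm_nonneg[of f] by simp
  define c where "c = complex_of_real (1 / L2norm p f)"
  have c: "cmod c = 1 / L2norm p f" using n by (simp add: c_def norm_divide)
  have "L2norm p (K (\<lambda>x. c * f x)) \<le> opnorm"
    unfolding opnorm_def using f n by (intro cSUP_upper opnorm_bdd) (auto simp: L2_scale L2norm_scale c)
  then have "1 / L2norm p f * L2norm p (K f) \<le> opnorm"
    using K_scale[OF f, of c] L2norm_scale[of c "K f"] by (simp add: c)
  then show ?thesis using n by (simp add: field_simps)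
qed

text \<open>The empty word alone gives \<open>phi\<close> a Rayleigh quotient of at least 1.
  Positivity of the norm is what later puts the threshold strictly below
  \<open>opnorm\<close>.\<close>

lemma opnorm_ge_1: "1 \<le> opnorm"
proof -
  have "1 \<le> cmod (inner_mu p phi (K phi))"
    using inner_phi_K_phi complex_Re_le_cmod by (rule order_trans)
  also have "\<dots> \<le> L2norm p phi * L2norm p (K phi)" by (rule Cauchy_Schwarz[OF phi_L2 K_L2[OF phi_L2]])
  also have "\<dots> \<le> 1 * L2norm p (K phi)" by (intro mult_right_mono L2norm_phi_le L2norm_nonneg)
  also have "\<dots> \<le> opnorm" unfolding opnorm_def mult_1
    using phi_L2 L2norm_phi_le by (intro cSUP_upper opnorm_bdd) auto
  finally show ?thesis .
qed

lemma opnorm_approx: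
  assumes "0 \<le> t" "t < opnorm"
  shows "\<exists>f\<in>L2 p. L2norm p f \<le> 1 \<and> t < L2norm p (K f)"
proof -
  have "{f \<in> L2 p. L2norm p f \<le> 1} \<noteq> {}" using phi_L2 L2norm_phi_le by blast
  then show ?thesis using assms(2) unfolding opnorm_def by (subst (asm) less_cSUP_iff[OF _ opnorm_bdd]) auto
qed

lemma K_zero: "K (\<lambda>x. 0) = (\<lambda>x. 0)"
  by (simp add: fun_eq_iff K_def level_def inner_mu_def)

section \<open>The resolvent at phi\<close>

lemma is_eigenvalue_iff:
  "is_eigenvalue p c \<longleftrightarrow> (\<exists>f\<in>L2 p. L2norm p f \<noteq> 0 \<and> (AE x in mu p. K f x = c * f x))"
proof -
  have "(AE x in mu p. Kinf p f x = c * f x) \<longleftrightarrow> (AE x in mu p. K f x = c * f x)" if "f \<in> L2 p" for f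
    using Kinf_AE[OF that] by (intro eventually_subst) (auto elim: eventually_mono)
  then show ?thesis unfolding is_eigenvalue_def by blast
qed

text \<open>For z > \<open>opnorm\<close> this is injectivity of z - K with an explicit
  constant.\<close>

lemma norm_resolvent_ge:
  assumes f: "f \<in> L2 p" and z: "0 \<le> z"
  shows "(z - opnorm) * L2norm p f \<le> L2norm p (\<lambda>x. complex_of_real z * f x - K f x)"
proof -
  have "(z - opnorm) * L2norm p f \<le> L2norm p (\<lambda>x. complex_of_real z * f x) - L2norm p (K f)"
    using opnorm_K[OF f] z by (simp add: L2norm_scale left_diff_distrib)
  also have "\<dots> \<le> L2norm p (\<lambda>x. complex_of_real z * f x - K f x)"
    by (intro L2norm_diff_ge L2_scale K_L2 f)
  finally show ?thesis .
qed

text \<open>The third bound feeds the Weierstrass test: the last application of \<open>K\<close>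
  converts the L2 bound of the previous iterate into a sup bound. Replacing the exponent n - 1 by n
  is harmless because \<open>opnorm\<close> is at least 1.\<close>

lemma K_power_phi:
  shows "(K ^^ n) phi \<in> L2 p"
    and "L2norm p ((K ^^ n) phi) \<le> opnorm ^ n"
    and "cmod ((K ^^ n) phi x) \<le> 1 / (1 - decay) * opnorm ^ n"
proof -
  show L: "(K ^^ n) phi \<in> L2 p" for n
    by (induction n) (auto simp: phi_L2 K_L2)
  show b: "L2norm p ((K ^^ n) phi) \<le> opnorm ^ n" for n
  proof (induction n)
    case (Suc n)
    have "L2norm p ((K ^^ Suc n) phi) \<le> opnorm * L2norm p ((K ^^ n) phi)"
      using opnorm_K[OF L] by simp
    also have "\<dots> \<le> opnorm * opnorm ^ n"
      using Suc opnorm_ge_1 by (intro mult_left_mono) auto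
    finally show ?case by simp
  qed (simp add: L2norm_phi_le)
  show "cmod ((K ^^ n) phi x) \<le> 1 / (1 - decay) * opnorm ^ n"
  proof (cases n)
    case 0
    then show ?thesis using decay_bounds by (simp add: phi_def indicator_def field_simps)
  next
    case (Suc m)
    have "cmod ((K ^^ n) phi x) \<le> 1 / (1 - decay) * L2norm p ((K ^^ m) phi)"
      using K_bound[OF L] Suc by simp
    also have "\<dots> \<le> 1 / (1 - decay) * opnorm ^ n"
    proof (intro mult_left_mono)
      show "L2norm p ((K ^^ m) phi) \<le> opnorm ^ n"
        using b[of m] power_increasing[of m n opnorm] opnorm_ge_1 Suc by linarith
    qed (use decay_bounds in simp)
    finally show ?thesis .
  qed
qed

text \<open>The witness is the Neumann series, the sum of z^-(n+1) K^n phi. It converges uniformly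
  since \<open>opnorm / z < 1\<close>.\<close>

lemma resolvent_exists:
  assumes z: "opnorm < z"
  shows "\<exists>\<psi>\<in>L2 p. AE x in mu p. complex_of_real z * \<psi> x - K \<psi> x = phi x"
proof -
  have z0: "0 < z" using z opnorm_ge_1 by linarith
  define u where "u n = (K ^^ n) phi" for n
  define v where "v n x = (1 / complex_of_real z ^ Suc n) * u n x" for n x
  define a where "a n = 1 / (1 - decay) / z * (opnorm / z) ^ n" for n
  have u: "u n \<in> L2 p" for n unfolding u_def by (rule K_power_phi)
  have v: "v n \<in> L2 p" for n unfolding v_def[abs_def] by (intro L2_scale u)
  have va: "cmod (v n x) \<le> a n" for n x
  proof -
    have "cmod (v n x) = cmod (u n x) / z ^ Suc n"
      using z0 by (simp add: v_def norm_mult norm_divide norm_power)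
    also have "\<dots> \<le> (1 / (1 - decay) * opnorm ^ n) / z ^ Suc n"
      unfolding u_def using z0 by (intro divide_right_mono K_power_phi) simp
    also have "\<dots> = a n" by (simp add: a_def power_divide)
    finally show ?thesis .
  qed
  have "summable a" unfolding a_def
    using z opnorm_ge_1 z0 by (intro summable_mult summable_geometric) auto
  note S = L2_series[of v a, OF L2_measurable[OF v] va this]
  define \<psi> where "\<psi> x = (\<Sum>n. v n x)" for x
  define s where "s m x = (\<Sum>n<m. v n x)" for m x
  have \<psi>: "\<psi> \<in> L2 p" using S(1) by (simp add: \<psi>_def[abs_def])
  have s: "s m \<in> L2 p" for m unfolding s_def[abs_def] by (intro L2_sum v)
  define e where "e m = L2norm p (\<lambda>x. s m x - \<psi> x)" for m
  have e: "e \<longlonglongrightarrow> 0" using S(3) by (simp add: e_def[abs_def] s_def \<psi>_def)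
  let ?z = "complex_of_real z"
  \<comment> \<open>Applying z - K to a partial sum telescopes, leaving \<open>phi\<close> minus a
    remainder of norm at most \<open>(opnorm / z) ^ m\<close>.\<close>
  have tele: "?z * s m x - K (s m) x = phi x - (1 / ?z ^ m) * u m x" for m x
  proof (induction m arbitrary: x)
    case 0
    show ?case by (simp add: s_def[abs_def] u_def K_zero)
  next
    case (Suc m)
    have s1: "s (Suc m) = (\<lambda>x. s m x + v m x)" by (simp add: s_def[abs_def])
    have Kv: "K (v m) = (\<lambda>x. (1 / ?z ^ Suc m) * u (Suc m) x)"
      unfolding v_def[abs_def] K_scale[OF u] by (simp add: u_def)
    have zv: "?z * v m x = (1 / ?z ^ m) * u m x" using z0 by (simp add: v_def)
    have "?z * s (Suc m) x - K (s (Suc m)) x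
        = (?z * s m x - K (s m) x) + ?z * v m x - (1 / ?z ^ Suc m) * u (Suc m) x"
      unfolding s1 K_add[OF s v] Kv by (simp only: algebra_simps)
    then show ?case unfolding Suc zv by simp
  qed
  define r where "r x = ?z * \<psi> x - K \<psi> x" for x
  have r: "r \<in> L2 p" unfolding r_def[abs_def] by (intro L2_diff L2_scale K_L2 \<psi>)
  \<comment> \<open>With d = s m - \<psi>, the error of the limit equation is (K - z) d minus the
    telescoping remainder, and both tend to 0 with m.\<close>
  have bound: "L2norm p (\<lambda>x. r x - phi x) \<le> (z + opnorm) * e m + (opnorm / z) ^ m" for m
  proof -
    define d where "d x = s m x - \<psi> x" for x
    have d: "d \<in> L2 p" unfolding d_def[abs_def] by (intro L2_diff s \<psi>)
    have Kd: "K d = (\<lambda>x. K (s m) x - K \<psi> x)"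
      unfolding d_def[abs_def] by (rule K_diff[OF s \<psi>])
    have eq: "r x - phi x = (K d x - ?z * d x) - (1 / ?z ^ m) * u m x" for x
      using tele[of m x] by (simp add: r_def Kd d_def algebra_simps)
    have tri: "L2norm p (\<lambda>x. g x - h x) \<le> L2norm p g + L2norm p h" if "g \<in> L2 p" "h \<in> L2 p" for g h
      using L2norm_add[of g "\<lambda>x. -1 * h x"] L2norm_scale[of "-1" h] L2_scale[of h "-1"] that by simp
    have "L2norm p (\<lambda>x. r x - phi x)
        \<le> L2norm p (\<lambda>x. K d x - ?z * d x) + L2norm p (\<lambda>x. (1 / ?z ^ m) * u m x)"
      unfolding eq by (intro tri L2_diff L2_scale K_L2 u d)
    also have "L2norm p (\<lambda>x. K d x - ?z * d x) \<le> L2norm p (K d) + L2norm p (\<lambda>x. ?z * d x)"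
      by (intro tri L2_scale K_L2 d)
    also have "L2norm p (K d) \<le> opnorm * e m"
      using opnorm_K[OF d] by (simp add: e_def d_def[abs_def])
    also have "L2norm p (\<lambda>x. ?z * d x) = z * e m"
      using z0 by (simp only: L2norm_scale) (simp add: e_def d_def[abs_def])
    also have "L2norm p (\<lambda>x. (1 / ?z ^ m) * u m x) \<le> (opnorm / z) ^ m"
      using K_power_phi(2)[of m] z0
      by (simp only: L2norm_scale) (simp add: u_def norm_divide norm_power power_divide divide_right_mono)
    finally show ?thesis by (simp add: algebra_simps)
  qed
  have "(\<lambda>m. (z + opnorm) * e m + (opnorm / z) ^ m) \<longlonglongrightarrow> (z + opnorm) * 0 + 0"
    using z z0 opnorm_ge_1 by (intro tendsto_intros e LIMSEQ_realpow_zero) auto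
  then have "L2norm p (\<lambda>x. r x - phi x) \<le> (z + opnorm) * 0 + 0"
    by (rule LIMSEQ_le_const) (use bound in blast)
  then have "L2norm p (\<lambda>x. r x - phi x) = 0" using L2norm_nonneg[of "\<lambda>x. r x - phi x"] by simp
  then have "AE x in mu p. r x = phi x" using L2norm_diff_eq_0_iff[OF r phi_L2] by simp
  then show ?thesis using \<psi> unfolding r_def by blast
qed

text \<open>\<open>resolvent_phi\<close> is a choice too. From here on only its equation is used,
  not the Neumann series.\<close>

lemma
  assumes "opnorm < z"
  shows resolvent_phi_L2: "resolvent_phi p (complex_of_real z) \<in> L2 p"
    and resolvent_phi_AE: "AE x in mu p. complex_of_real z * resolvent_phi p (complex_of_real z) x
      - K (resolvent_phi p (complex_of_real z)) x = phi x"
proof -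
  let ?R = "resolvent_phi p (complex_of_real z)"
  obtain \<psi> where \<psi>: "\<psi> \<in> L2 p" "AE x in mu p. complex_of_real z * \<psi> x - K \<psi> x = phi x"
    using resolvent_exists[OF assms] by blast
  have "AE x in mu p. complex_of_real z * \<psi> x - Kinf p \<psi> x = phi x"
    using \<psi>(2) Kinf_AE[OF \<psi>(1)] by eventually_elim simp
  with \<psi>(1) have "\<psi> \<in> L2 p \<and> (AE x in mu p. complex_of_real z * \<psi> x - Kinf p \<psi> x = phi x)"
    by (rule conjI)
  then have *: "?R \<in> L2 p \<and> (AE x in mu p. complex_of_real z * ?R x - Kinf p ?R x = phi x)"
    unfolding resolvent_phi_def 
    by (rule someI[where P = "\<lambda>\<psi>. \<psi> \<in> L2 p \<and> (AE x in mu p. complex_of_real z * \<psi> x - Kinf p \<psi> x = phi x)"])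
  then show R: "?R \<in> L2 p" by blast
  from * have "AE x in mu p. complex_of_real z * ?R x - Kinf p ?R x = phi x" by blast
  with Kinf_AE[OF R] show "AE x in mu p. complex_of_real z * ?R x - K ?R x = phi x"
    by eventually_elim simp
qed

end

section \<open>Eigenvalues above the threshold\<close>

text \<open>The threshold uses \<open>opnorm\<close> because its equality with
  \<open>lambda_max p\<close> is itself derived by interpreting this locale at lam =
  \<open>opnorm\<close>. The assumption puts \<open>lam / weight p d\<close> above
  \<open>opnorm\<close> on both branches.\<close>

locale cantor_above_threshold = cantor_measure +
  fixes lam :: real
  assumes lam_gt: "max p (1 - p) * opnorm < lam"
begin

lemma lam_weight: "opnorm < lam / weight p d"
proof -
  have "weight p d * opnorm \<le> max p (1 - p) * opnorm"
    using opnorm_ge_1 by (intro mult_right_mono) (auto simp: weight_def)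
  then have "opnorm * weight p d < lam" using lam_gt by (simp add: mult.commute)
  then show ?thesis using weight_pos[of d] by (simp add: pos_less_divide_eq)
qed

lemma lam_weight_nonneg: "0 \<le> lam / weight p d"
  using lam_weight[of d] opnorm_ge_1 by linarith

definition R :: "nat \<Rightarrow> real \<Rightarrow> complex" where
  "R d = resolvent_phi p (complex_of_real (lam / weight p d))"

definition F :: complex where
  "F = (\<Sum>d\<in>{0,2}. inner_mu p phi (R d))"

lemma F_eq_mfun: "F = mfun p (complex_of_real (lam / p)) + mfun p (complex_of_real (lam / (1 - p)))"
  by (simp add: F_def R_def mfun_def weight_def)

lemma R_L2: "R d \<in> L2 p"
  unfolding R_def by (rule resolvent_phi_L2[OF lam_weight])

lemma R_AE: "AE x in mu p. complex_of_real (lam / weight p d) * R d x - K (R d) x = 1"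
  using resolvent_phi_AE[OF lam_weight, of d] AE_phi unfolding R_def[symmetric]
  by eventually_elim simp

definition residual :: "(real \<Rightarrow> complex) \<Rightarrow> real \<Rightarrow> complex" where
  "residual f x = complex_of_real lam * f x - K f x"

text \<open>The distance of a branch of f from the form that the eigenvalue equation would force on
  it. Keeping defects instead of equations lets the same estimates serve exact eigenfunctions and
  the lower bound on \<open>residual\<close>.\<close>

definition branch_defect :: "(real \<Rightarrow> complex) \<Rightarrow> nat \<Rightarrow> real \<Rightarrow> complex" where
  "branch_defect f d x = f (Smap d x) - inner_mu p phi f / weight p d * R d x"

lemma residual_L2: "f \<in> L2 p \<Longrightarrow> residual f \<in> L2 p"
  unfolding residual_def[abs_def] by (intro L2_diff L2_scale K_L2)

lemma branch_defect_L2: "f \<in> L2 p \<Longrightarrow> d \<in> {0,2} \<Longrightarrow> branch_defect f d \<in> L2 p"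
  unfolding branch_defect_def[abs_def] by (intro L2_diff L2_scale L2_Smap R_L2)

text \<open>Applying \<open>lam / weight p d\<close> - K to the defect gives the branch of the
  residual divided by the weight: the constant from \<open>K_Smap\<close> cancels against the
  right-hand side of the equation for \<open>R d\<close>. Then \<open>norm_resolvent_ge\<close>
  applies.\<close>

lemma norm_branch_defect:
  assumes f: "f \<in> L2 p" and d: "d \<in> {0,2}"
  shows "(lam / weight p d - opnorm) * L2norm p (branch_defect f d)
     \<le> L2norm p (\<lambda>x. residual f (Smap d x)) / weight p d"
proof -
  let ?h = "branch_defect f d" and ?w = "complex_of_real (weight p d)"
  let ?c = "inner_mu p phi f / ?w" and ?z = "complex_of_real (lam / weight p d)"
  note h = branch_defect_L2[OF f d] and w = weight_pos[of d]
  have Kh: "K ?h = (\<lambda>x. K (\<lambda>x. f (Smap d x)) x - ?c * K (R d) x)"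
    unfolding branch_defect_def[abs_def]
    by (simp only: K_diff[OF L2_Smap[OF f d] L2_scale[OF R_L2]] K_scale[OF R_L2])
  have "AE x in mu p. ?z * ?h x - K ?h x = 1 / ?w * residual f (Smap d x)"
    using AE_cantor_set R_AE[of d]
  proof eventually_elim
    case (elim x)
    have KR: "K (R d) x = ?z * R d x - 1" using elim(2) by (simp add: algebra_simps)
    show ?case
      unfolding Kh KR residual_def K_Smap[OF d f elim(1)] branch_defect_def
      using w by (simp add: field_simps)
  qed
  then have "L2norm p (\<lambda>x. ?z * ?h x - K ?h x) = L2norm p (\<lambda>x. 1 / ?w * residual f (Smap d x))"
    by (rule L2norm_cong_AE) (intro L2_diff L2_scale K_L2 h L2_Smap residual_L2 f d)+
  also have "\<dots> = L2norm p (\<lambda>x. residual f (Smap d x)) / weight p d"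
    using w by (simp only: L2norm_scale) (simp add: norm_divide)
  finally show ?thesis using norm_resolvent_ge[OF h lam_weight_nonneg[of d]] by simp
qed

text \<open>The weights reassemble <phi, f> from its branches and cancel the division by the weight
  in front of \<open>R d\<close>, so that the second part sums to <phi, f> \<open>F\<close>.\<close>

lemma inner_phi_branch_defect:
  assumes f: "f \<in> L2 p"
  shows "inner_mu p phi f * (1 - F) = (\<Sum>d\<in>{0,2}. weight p d * inner_mu p phi (branch_defect f d))"
proof -
  have "weight p d * inner_mu p phi (branch_defect f d)
      = weight p d * inner_mu p phi (\<lambda>x. f (Smap d x)) - inner_mu p phi f * inner_mu p phi (R d)"
    if d: "d \<in> {0,2}" for d
    unfolding branch_defect_def[abs_def] using weight_pos[of d]
    by (simp only: inner_diff_right[OF phi_L2 L2_Smap[OF f d] L2_scale[OF R_L2]] inner_scale_right)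
      (simp add: algebra_simps)
  then have "(\<Sum>d\<in>{0,2}. weight p d * inner_mu p phi (branch_defect f d))
      = (\<Sum>d\<in>{0,2}. weight p d * inner_mu p phi (\<lambda>x. f (Smap d x)))
        - (\<Sum>d\<in>{0,2}. inner_mu p phi f * inner_mu p phi (R d))"
    unfolding sum_subtractf[symmetric] by (intro sum.cong refl)
  also have "\<dots> = inner_mu p phi f - inner_mu p phi f * F"
    by (simp only: inner_phi_Smap[OF f, symmetric] F_def sum_distrib_left)
  finally have "(\<Sum>d\<in>{0,2}. weight p d * inner_mu p phi (branch_defect f d))
      = inner_mu p phi f - inner_mu p phi f * F" .
  then show ?thesis by (simp add: right_diff_distrib)
qed

text \<open>A vanishing residual makes both defects vanish, by
  \<open>norm_branch_defect\<close>.\<close>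

lemma eigenfunction_structure:
  assumes f: "f \<in> L2 p" and eig: "AE x in mu p. K f x = complex_of_real lam * f x"
  shows "inner_mu p phi f * (1 - F) = 0"
    and "d \<in> {0,2} \<Longrightarrow> AE x in mu p. f (Smap d x) = inner_mu p phi f / weight p d * R d x"
proof -
  have "AE x in mu p. residual f x = 0"
    using eig unfolding residual_def by eventually_elim simp
  moreover have "Measurable.pred borel (\<lambda>x. residual f x = 0)"
    using L2_measurable[OF residual_L2[OF f]] by measurable
  ultimately have res: "AE x in mu p. residual f (Smap d x) = 0" if "d \<in> {0,2}" for d
    using AE_self_similar_iff that by blast
  have zero: "L2norm p (branch_defect f d) = 0" if d: "d \<in> {0,2}" for d
  proof -
    have "L2norm p (\<lambda>x. residual f (Smap d x)) = 0"
      using res[OF d] L2norm_eq_0_iff[OF L2_Smap[OF residual_L2[OF f] d]] by simp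
    then have "(lam / weight p d - opnorm) * L2norm p (branch_defect f d) \<le> 0"
      using norm_branch_defect[OF f d] by simp
    then show ?thesis using lam_weight[of d] L2norm_nonneg[of "branch_defect f d"]
      by (simp add: mult_le_0_iff)
  qed
  have "inner_mu p phi (branch_defect f d) = 0" if d: "d \<in> {0,2}" for d
    using Cauchy_Schwarz[OF phi_L2 branch_defect_L2[OF f d]] zero[OF d] by simp
  then show "inner_mu p phi f * (1 - F) = 0"
    unfolding inner_phi_branch_defect[OF f] by simp
  show "AE x in mu p. f (Smap d x) = inner_mu p phi f / weight p d * R d x" if d: "d \<in> {0,2}"
    using zero[OF d] L2norm_eq_0_iff[OF branch_defect_L2[OF f d]] by (simp add: branch_defect_def)
qed

text \<open>Both branches of an eigenfunction are multiples of <phi, f>; were it 0, f would vanish.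
  This permits cancelling it to obtain \<open>F = 1\<close> and taking ratios for
  simplicity.\<close>

lemma eigenfunction_inner_phi_nonzero:
  assumes f: "f \<in> L2 p" and n: "L2norm p f \<noteq> 0" and eig: "AE x in mu p. K f x = complex_of_real lam * f x"
  shows "inner_mu p phi f \<noteq> 0"
proof
  assume "inner_mu p phi f = 0"
  then have "\<forall>d\<in>{0,2}. AE x in mu p. f (Smap d x) = 0"
    using eigenfunction_structure(2)[OF f eig] by simp
  moreover have "Measurable.pred borel (\<lambda>x. f x = 0)"
    using L2_measurable[OF f] by measurable
  ultimately have "AE x in mu p. f x = 0" using AE_self_similar_iff by blast
  then show False using n L2norm_eq_0_iff[OF f] by simp
qed

lemma eigenfunctions_proportional:
  assumes f: "f \<in> L2 p" and n: "L2norm p f \<noteq> 0" and eig: "AE x in mu p. K f x = complex_of_real lam * f x"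
    and g: "g \<in> L2 p" and eig': "AE x in mu p. K g x = complex_of_real lam * g x"
  shows "\<exists>a. AE x in mu p. g x = a * f x"
proof
  let ?a = "inner_mu p phi g / inner_mu p phi f"
  have "AE x in mu p. g (Smap d x) = ?a * f (Smap d x)" if "d \<in> {0,2}" for d
    using eigenfunction_structure(2)[OF f eig that] eigenfunction_structure(2)[OF g eig' that]
    by eventually_elim (simp add: eigenfunction_inner_phi_nonzero[OF f n eig])
  moreover have "Measurable.pred borel (\<lambda>x. g x = ?a * f x)"
    using L2_measurable[OF f] L2_measurable[OF g] by measurable
  ultimately show "AE x in mu p. g x = ?a * f x" using AE_self_similar_iff by blast
qed

lemma eigenvalue_imp_F:
  assumes "is_eigenvalue p (complex_of_real lam)" shows "F = 1"
proof -
  obtain f where f: "f \<in> L2 p" "L2norm p f \<noteq> 0" "AE x in mu p. K f x = complex_of_real lam * f x"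
    using assms is_eigenvalue_iff by blast
  show ?thesis using eigenfunction_structure(1)[OF f(1,3)] eigenfunction_inner_phi_nonzero[OF f] by simp
qed

lemma F_imp_eigenvalue:
  assumes F: "F = 1" shows "is_eigenvalue p (complex_of_real lam)"
proof -
  \<comment> \<open>Glued so that branch d is \<open>R d / weight p d\<close>, the forced form with
    <phi, f> = 1; \<open>3 * x\<close> and \<open>3 * x - 2\<close> invert the two branches.\<close>
  define f where "f x = (if x \<le> 1/2 then R 0 (3 * x) / weight p 0 else R 2 (3 * x - 2) / weight p 2)" for x
  note [measurable] = L2_measurable[OF R_L2]
  have fm[measurable]: "f \<in> borel_measurable borel" unfolding f_def[abs_def] by measurable
  have fS: "AE x in mu p. f (Smap d x) = 1 / weight p d * R d x" if "d \<in> {0,2}" for d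
    using AE_unit by eventually_elim (use that in \<open>auto simp: f_def Smap_def add_divide_distrib\<close>)
  have RL: "(\<lambda>x. 1 / weight p d * R d x) \<in> L2 p" for d by (intro L2_scale R_L2)
  have "(\<lambda>x. f (Smap d x)) \<in> L2 p" if d: "d \<in> {0,2}" for d
  proof (rule L2_I)
    show m: "(\<lambda>x. f (Smap d x)) \<in> borel_measurable borel" by measurable
    have "integrable (mu p) (\<lambda>x. (cmod (f (Smap d x)))\<^sup>2) \<longleftrightarrow> integrable (mu p) (\<lambda>x. (cmod (1 / weight p d * R d x))\<^sup>2)"
    proof (rule integrable_cong_AE)
      show "AE x in mu p. (cmod (f (Smap d x)))\<^sup>2 = (cmod (1 / weight p d * R d x))\<^sup>2"
        using fS[OF d] by eventually_elim simp
    qed measurable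
    then show "integrable (mu p) (\<lambda>x. (cmod (f (Smap d x)))\<^sup>2)" using L2_square_integrable[OF RL] by simp
  qed
  then have f: "f \<in> L2 p" using L2_Smap_iff[OF fm] by blast
  have "inner_mu p phi (\<lambda>x. f (Smap d x)) = 1 / weight p d * inner_mu p phi (R d)" if d: "d \<in> {0,2}" for d
    unfolding inner_scale_right[symmetric]
    by (rule inner_cong_AE[OF _ fS[OF d] phi_L2 phi_L2 L2_Smap[OF f d] RL]) simp
  \<comment> \<open>This value does not depend on \<open>F\<close> being 1; the hypothesis then
    makes it agree with the normalisation built into f.\<close>
  then have "inner_mu p phi f = F"
    using weight_pos[of 0] weight_pos[of 2] by (simp add: inner_phi_Smap[OF f] F_def)
  then have c: "inner_mu p phi f = 1" using F by simp
  have "AE x in mu p. K f (Smap d x) = complex_of_real lam * f (Smap d x)" if d: "d \<in> {0,2}" for d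
  proof -
    have K: "K (\<lambda>x. f (Smap d x)) = (\<lambda>x. 1 / weight p d * K (R d) x)"
      unfolding K_cong_AE[OF fS[OF d] L2_Smap[OF f d] RL] by (rule K_scale[OF R_L2])
    show ?thesis using AE_cantor_set R_AE[of d] fS[OF d]
    proof eventually_elim
      case (elim x)
      have KR: "K (R d) x = complex_of_real (lam / weight p d) * R d x - 1"
        using elim(2) by (simp add: algebra_simps)
      show ?case unfolding K_Smap[OF d f elim(1)] K elim(3) KR
        using weight_pos[of d] by (simp add: c)
    qed
  qed
  moreover have "Measurable.pred borel (\<lambda>x. K f x = complex_of_real lam * f x)"
    using L2_measurable[OF K_L2[OF f]] by measurable
  ultimately have "AE x in mu p. K f x = complex_of_real lam * f x" using AE_self_similar_iff by blast
  moreover have "L2norm p f \<noteq> 0" using Cauchy_Schwarz[OF phi_L2 f] by (auto simp: c)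
  ultimately show ?thesis using f is_eigenvalue_iff by blast
qed

lemma eigenvalue_iff_F: "is_eigenvalue p (complex_of_real lam) \<longleftrightarrow> F = 1"
  using eigenvalue_imp_F F_imp_eigenvalue by blast

lemma eigenvalue_simple:
  assumes "is_eigenvalue p (complex_of_real lam)"
  shows "is_simple_eigenvalue p (complex_of_real lam)"
  unfolding is_simple_eigenvalue_def
proof (intro conjI ballI impI assms)
  fix f g assume f: "f \<in> L2 p" and g: "g \<in> L2 p" and n: "L2norm p f \<noteq> 0"
    and ef: "AE x in mu p. Kinf p f x = complex_of_real lam * f x"
    and eg: "AE x in mu p. Kinf p g x = complex_of_real lam * g x"
  have "AE x in mu p. K f x = complex_of_real lam * f x"
    using ef Kinf_AE[OF f] by eventually_elim simp
  moreover have "AE x in mu p. K g x = complex_of_real lam * g x"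
    using eg Kinf_AE[OF g] by eventually_elim simp
  ultimately show "\<exists>a. AE x in mu p. g x = a * f x"
    using eigenfunctions_proportional[OF f n _ g] by blast
qed

text \<open>The quantitative form of \<open>eigenfunction_structure\<close>: small residual, small
  defects; dividing by 1 - \<open>F\<close> bounds <phi, f>; together they bound both branches of
  f.\<close>

lemma residual_bounded_below:
  assumes F: "F \<noteq> 1"
  shows "\<exists>B>0. \<forall>f\<in>L2 p. L2norm p f \<le> B * L2norm p (residual f)"
proof -
  \<comment> \<open>Defect bound. One factor of the weight comes from
    \<open>norm_branch_defect\<close>, the other from estimating a branch of the residual by the
    whole.\<close>
  define A where "A d = 1 / ((weight p d)\<^sup>2 * (lam / weight p d - opnorm))" for d
  \<comment> \<open>Branch bound: the defect plus the multiple of \<open>R d\<close>, whose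
    coefficient <phi, f> is controlled by \<open>(A 0 + A 2) / cmod (1 - F)\<close>.\<close>
  define B where "B d = A d + (A 0 + A 2) / cmod (1 - F) * (L2norm p (R d) / weight p d)" for d
  have A: "0 < A d" for d
    using weight_pos[of d] lam_weight[of d] by (simp add: A_def)
  have B: "0 < B d" for d
    using A[of d] A[of 0] A[of 2] weight_pos[of d] L2norm_nonneg[of "R d"]
    by (auto simp: B_def intro!: add_pos_nonneg mult_nonneg_nonneg)
  have "L2norm p f \<le> (B 0 + B 2) * L2norm p (residual f)" if f: "f \<in> L2 p" for f
  proof -
    let ?c = "inner_mu p phi f" and ?g = "L2norm p (residual f)"
    have g: "0 \<le> ?g" by (rule L2norm_nonneg)
    have h: "L2norm p (branch_defect f d) \<le> A d * ?g" if d: "d \<in> {0,2}" for d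
    proof -
      have w: "0 < weight p d" and l: "0 < lam / weight p d - opnorm"
        using weight_pos[of d] lam_weight[of d] by auto
      have "weight p d * L2norm p (\<lambda>x. residual f (Smap d x)) \<le> decay * ?g"
        by (rule weight_L2norm_Smap_le[OF residual_L2[OF f] d])
      also have "\<dots> \<le> 1 * ?g" using decay_bounds g by (intro mult_right_mono) auto
      finally have "L2norm p (\<lambda>x. residual f (Smap d x)) / weight p d \<le> ?g / (weight p d)\<^sup>2"
        using w by (simp add: field_simps power2_eq_square)
      then have "(lam / weight p d - opnorm) * L2norm p (branch_defect f d) \<le> ?g / (weight p d)\<^sup>2"
        using norm_branch_defect[OF f d] by linarith
      then have "L2norm p (branch_defect f d) \<le> ?g / (weight p d)\<^sup>2 / (lam / weight p d - opnorm)"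
        unfolding pos_le_divide_eq[OF l] by (simp only: mult.commute)
      then show ?thesis by (simp add: A_def)
    qed
    have "cmod ?c * cmod (1 - F) = cmod (\<Sum>d\<in>{0,2}. weight p d * inner_mu p phi (branch_defect f d))"
      using inner_phi_branch_defect[OF f] by (metis norm_mult)
    also have "\<dots> \<le> (\<Sum>d\<in>{0,2}. cmod (weight p d * inner_mu p phi (branch_defect f d)))"
      by (rule norm_sum)
    also have "\<dots> \<le> (\<Sum>d\<in>{0,2}. A d * ?g)"
    proof (rule sum_mono)
      fix d :: nat assume d: "d \<in> {0,2}"
      have "cmod (inner_mu p phi (branch_defect f d)) \<le> L2norm p phi * L2norm p (branch_defect f d)"
        by (rule Cauchy_Schwarz[OF phi_L2 branch_defect_L2[OF f d]])
      also have "\<dots> \<le> 1 * (A d * ?g)"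
        by (intro mult_mono L2norm_phi_le h d L2norm_nonneg) simp
      finally have "weight p d * cmod (inner_mu p phi (branch_defect f d)) \<le> 1 * (A d * ?g)"
        using weight_pos[of d] weight_le_1[of d] by (intro mult_mono) auto
      then show "cmod (weight p d * inner_mu p phi (branch_defect f d)) \<le> A d * ?g"
        using weight_pos[of d] by (simp add: norm_mult)
    qed
    finally have c: "cmod ?c \<le> (A 0 + A 2) / cmod (1 - F) * ?g"
      using F by (simp add: field_simps)
    have fd: "L2norm p (\<lambda>x. f (Smap d x)) \<le> B d * ?g" if d: "d \<in> {0,2}" for d
    proof -
      have "L2norm p (\<lambda>x. f (Smap d x)) - L2norm p (\<lambda>x. ?c / weight p d * R d x)
          \<le> L2norm p (branch_defect f d)"
        unfolding branch_defect_def[abs_def] by (intro L2norm_diff_ge L2_Smap L2_scale f d R_L2)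
      then have "L2norm p (\<lambda>x. f (Smap d x))
          \<le> A d * ?g + L2norm p (\<lambda>x. ?c / weight p d * R d x)"
        using h[OF d] by linarith
      also have "L2norm p (\<lambda>x. ?c / weight p d * R d x) = cmod ?c * (L2norm p (R d) / weight p d)"
        using weight_pos[of d] by (simp only: L2norm_scale) (simp add: norm_divide)
      also have "\<dots> \<le> (A 0 + A 2) / cmod (1 - F) * ?g * (L2norm p (R d) / weight p d)"
        using c weight_pos[of d] by (intro mult_right_mono) (auto simp: L2norm_nonneg)
      finally show ?thesis unfolding B_def distrib_right by (simp only: mult_ac)
    qed
    have "(L2norm p f)\<^sup>2 = (\<Sum>d\<in>{0,2}. weight p d * (L2norm p (\<lambda>x. f (Smap d x)))\<^sup>2)"
      by (rule L2norm_self_similar[OF f])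
    also have "\<dots> \<le> (\<Sum>d\<in>{0,2}. 1 * (B d * ?g)\<^sup>2)"
      using fd weight_le_1 weight_pos[THEN less_imp_le] L2norm_nonneg
      by (intro sum_mono mult_mono power_mono) auto
    also have "\<dots> \<le> ((B 0 + B 2) * ?g)\<^sup>2"
      using B[of 0] B[of 2] g by (simp add: power2_sum distrib_right)
    finally show ?thesis
      by (rule power2_le_imp_le) (use B[of 0] B[of 2] g in simp)
  qed
  then show ?thesis using B[of 0] B[of 2] by (intro exI[of _ "B 0 + B 2"]) auto
qed

end

section \<open>The largest eigenvalue\<close>

context cantor_measure
begin

text \<open>Write N = \<open>opnorm\<close> and g = (N - K) f. Positivity gives N ||g|| \<le> ||(N +
  K) g|| = ||(N^2 - K^2) f||. Expanding the square with <f, K^2 f> = ||K f||^2 and ||K^2 f|| \<le> N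
  ||K f|| yields N^2 times the claim.\<close>

lemma norm_residual_opnorm:
  assumes f: "f \<in> L2 p" and f1: "L2norm p f \<le> 1"
  shows "(L2norm p (\<lambda>x. complex_of_real opnorm * f x - K f x))\<^sup>2 \<le> opnorm\<^sup>2 - (L2norm p (K f))\<^sup>2"
proof -
  let ?N = "complex_of_real opnorm"
  define g where "g x = ?N * f x - K f x" for x
  define q where "q x = ?N\<^sup>2 * f x" for x
  note Kf = K_L2[OF f] and KKf = K_L2[OF K_L2[OF f]]
  have g: "g \<in> L2 p" and q: "q \<in> L2 p" and Ng: "(\<lambda>x. ?N * g x) \<in> L2 p"
    unfolding g_def[abs_def] q_def[abs_def] by (intro L2_diff L2_scale f Kf)+
  have Kg: "K g = (\<lambda>x. ?N * K f x - K (K f) x)"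
    unfolding g_def[abs_def] by (simp only: K_diff[OF L2_scale[OF f] Kf] K_scale[OF f])
  have eq: "(\<lambda>x. ?N * g x + K g x) = (\<lambda>x. q x + (-1) * K (K f) x)"
    by (simp add: Kg g_def q_def algebra_simps power2_eq_square)
  have norm_q: "L2norm p q = opnorm\<^sup>2 * L2norm p f"
    unfolding q_def[abs_def] L2norm_scale by (simp add: norm_power)
  have inner_q: "inner_mu p q h = complex_of_real (opnorm\<^sup>2) * inner_mu p f h" for h
    unfolding q_def[abs_def] inner_scale_left by simp
  have N0: "0 \<le> opnorm" using opnorm_ge_1 by linarith
  have "opnorm\<^sup>2 * (L2norm p g)\<^sup>2 \<le> (L2norm p (\<lambda>x. ?N * g x + K g x))\<^sup>2"
    unfolding L2norm_add_square[OF Ng K_L2[OF g]] inner_scale_left L2norm_scale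
    using K_positive[OF g] N0 by (simp add: power_mult_distrib)
  also have "\<dots> = (opnorm\<^sup>2 * L2norm p f)\<^sup>2 - 2 * opnorm\<^sup>2 * Re (inner_mu p f (K (K f))) + (L2norm p (K (K f)))\<^sup>2"
    unfolding eq L2norm_add_square[OF q L2_scale[OF KKf]] norm_q inner_scale_right inner_q
      L2norm_scale[of "-1"] by (simp del: of_real_power)
  also have "inner_mu p f (K (K f)) = complex_of_real ((L2norm p (K f))\<^sup>2)"
    unfolding K_symmetric[OF Kf f] by (rule inner_self)
  also have "(L2norm p (K (K f)))\<^sup>2 \<le> opnorm\<^sup>2 * (L2norm p (K f))\<^sup>2"
    using power_mono[OF opnorm_K[OF Kf] L2norm_nonneg, of 2] by (simp add: power_mult_distrib)
  also have "(opnorm\<^sup>2 * L2norm p f)\<^sup>2 \<le> (opnorm\<^sup>2)\<^sup>2"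
    using f1 by (intro power_mono mult_left_le) (auto simp: L2norm_nonneg)
  finally have *: "opnorm\<^sup>2 * (L2norm p g)\<^sup>2 \<le> (opnorm\<^sup>2)\<^sup>2
      - 2 * opnorm\<^sup>2 * Re (complex_of_real ((L2norm p (K f))\<^sup>2)) + opnorm\<^sup>2 * (L2norm p (K f))\<^sup>2"
    by simp
  have "opnorm\<^sup>2 * (L2norm p g)\<^sup>2 \<le> opnorm\<^sup>2 * (opnorm\<^sup>2 - (L2norm p (K f))\<^sup>2)"
    using * unfolding power2_eq_square[of "opnorm\<^sup>2"]
    by (simp add: algebra_simps del: of_real_power)
  then have "(L2norm p g)\<^sup>2 \<le> opnorm\<^sup>2 - (L2norm p (K f))\<^sup>2"
    using opnorm_ge_1 by (subst (asm) mult_le_cancel_left_pos) auto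
  then show ?thesis unfolding g_def[abs_def] .
qed

lemma threshold_less_opnorm: "max p (1 - p) * opnorm < opnorm"
  using p_pos p_less_1 opnorm_ge_1 by simp

lemma opnorm_eigenvalue: "is_eigenvalue p (complex_of_real opnorm)"
proof (rule ccontr)
  assume no: "\<not> is_eigenvalue p (complex_of_real opnorm)"
  interpret cantor_above_threshold p opnorm
    by standard (rule threshold_less_opnorm)
  obtain B where B: "0 < B" "\<And>f. f \<in> L2 p \<Longrightarrow> L2norm p f \<le> B * L2norm p (residual f)"
    using residual_bounded_below no eigenvalue_iff_F by blast
  have N: "0 < opnorm" using opnorm_ge_1 by linarith
  define b where "b = (opnorm * B)\<^sup>2"
  \<comment> \<open>If N = \<open>opnorm\<close> is no eigenvalue, k = ||K f||^2 satisfies k \<le> b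
    (N^2 - k) for all f of norm at most 1, that is k \<le> N^2 b / (1 + b). So t is a bound on ||K
    f|| strictly below its supremum.\<close>
  define t where "t = sqrt (opnorm\<^sup>2 * (b / (1 + b)))"
  have b: "0 < b" using B N by (simp add: b_def)
  have t2: "t\<^sup>2 = opnorm\<^sup>2 * (b / (1 + b))" and t0: "0 \<le> t" using b by (auto simp: t_def)
  have "t\<^sup>2 < opnorm\<^sup>2" unfolding t2 using b N by (simp add: field_simps)
  then have "t < opnorm" by (rule power2_less_imp_less) (use N in simp)
  then obtain f where f: "f \<in> L2 p" "L2norm p f \<le> 1" and t: "t < L2norm p (K f)"
    using opnorm_approx[OF t0] by blast
  let ?k = "(L2norm p (K f))\<^sup>2"
  have "L2norm p (K f) \<le> opnorm * (B * L2norm p (residual f))"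
    using opnorm_K[OF f(1)] mult_left_mono[OF B(2)[OF f(1)], of opnorm] N by linarith
  then have "?k \<le> (opnorm * (B * L2norm p (residual f)))\<^sup>2"
    by (intro power_mono L2norm_nonneg)
  then have "?k \<le> b * (L2norm p (residual f))\<^sup>2"
    by (simp add: b_def power_mult_distrib mult.assoc)
  also have "\<dots> \<le> b * (opnorm\<^sup>2 - ?k)"
    using norm_residual_opnorm[OF f] b unfolding residual_def[abs_def] by simp
  finally have "?k * (1 + b) \<le> opnorm\<^sup>2 * b" by (simp add: algebra_simps)
  then have "?k \<le> t\<^sup>2" unfolding t2 using b by (simp add: field_simps)
  moreover have "t\<^sup>2 < ?k" using t t0 by (intro power_strict_mono) auto
  ultimately show False by linarith
qed

lemma eigenvalue_le_opnorm:
  assumes "is_eigenvalue p (complex_of_real r)" shows "r \<le> opnorm"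
proof -
  obtain f where f: "f \<in> L2 p" "L2norm p f \<noteq> 0" "AE x in mu p. K f x = complex_of_real r * f x"
    using assms is_eigenvalue_iff by blast
  have "L2norm p (K f) = \<bar>r\<bar> * L2norm p f"
    using L2norm_cong_AE[OF f(3) K_L2[OF f(1)] L2_scale[OF f(1)]] by (simp add: L2norm_scale)
  then have "\<bar>r\<bar> * L2norm p f \<le> opnorm * L2norm p f" using opnorm_K[OF f(1)] by simp
  then show ?thesis using f(2) L2norm_nonneg[of f] by (simp add: mult_le_cancel_right)
qed

lemma lambda_max_eq_opnorm: "lambda_max p = opnorm"
  unfolding lambda_max_def
  using opnorm_eigenvalue eigenvalue_le_opnorm by (rule Greatest_equality)

end

theorem theorem7p6:
  fixes p :: real
  assumes "0 < p" and "p < 1"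
  defines "L \<equiv> lambda_max p"
      and "alpha \<equiv> max p (1 - p)"
  shows "(\<forall>lam::real. lam > alpha * L \<longrightarrow>
            (is_eigenvalue p (complex_of_real lam) \<longleftrightarrow>
             mfun p (complex_of_real (lam / p)) + mfun p (complex_of_real (lam / (1 - p))) = 1))
       \<and> (\<forall>lam::real. lam > alpha * L \<longrightarrow> is_eigenvalue p (complex_of_real lam) \<longrightarrow>
            is_simple_eigenvalue p (complex_of_real lam))
       \<and> (L > alpha * L \<and>
          mfun p (complex_of_real (L / p)) + mfun p (complex_of_real (L / (1 - p))) = 1 \<and>
          (\<forall>lam::real. lam > alpha * L \<and>
             mfun p (complex_of_real (lam / p)) + mfun p (complex_of_real (lam / (1 - p))) = 1
             \<longrightarrow> lam \<le> L))
       \<and> is_simple_eigenvalue p (complex_of_real L)"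
proof -
  interpret cantor_measure p by standard fact+
  have L: "L = opnorm" unfolding L_def by (rule lambda_max_eq_opnorm)
  have above: "cantor_above_threshold p lam" if "lam > alpha * L" for lam
    using that unfolding L alpha_def by unfold_locales
  have iff: "is_eigenvalue p (complex_of_real lam) \<longleftrightarrow>
      mfun p (complex_of_real (lam / p)) + mfun p (complex_of_real (lam / (1 - p))) = 1"
    if "lam > alpha * L" for lam
    using cantor_above_threshold.eigenvalue_iff_F[OF above[OF that]]
      cantor_above_threshold.F_eq_mfun[OF above[OF that]] by simp
  have simple: "is_simple_eigenvalue p (complex_of_real lam)"
    if "lam > alpha * L" "is_eigenvalue p (complex_of_real lam)" for lam
    using cantor_above_threshold.eigenvalue_simple[OF above[OF that(1)] that(2)] .
  have le: "lam \<le> L" if "is_eigenvalue p (complex_of_real lam)" for lam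
    unfolding L using that by (rule eigenvalue_le_opnorm)
  have gt: "L > alpha * L" unfolding L alpha_def by (rule threshold_less_opnorm)
  have eig: "is_eigenvalue p (complex_of_real L)" unfolding L by (rule opnorm_eigenvalue)
  show ?thesis
  proof (intro conjI allI impI)
    show "mfun p (complex_of_real (L / p)) + mfun p (complex_of_real (L / (1 - p))) = 1"
      using iff[OF gt] eig by blast
  qed (use iff simple gt eig le in auto)
qed

end
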